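(* Let $A$ be a projective cube over $\mathcal{O}_K$ with $\operatorname{Disc}(A)\in\mathcal{D}$, and let $Q_1,Q_2,Q_3$ be the three quadratic forms attached to $A$. Then the composition $[Q_1][Q_2][Q_3]$ in the group $\mathcal{QF}_{\mathcal{D}}$ is the identity element, i.e. it is the class of $x^2-(\Omega+\overline{\Omega})xy+\Omega\overline{\Omega}y^2$.
   Context: $K$ is a number field of narrow class number one with real embeddings $\sigma_1,\dots,\sigma_r$, ring of integers $\mathcal{O}_K$, units $\mathcal{U}_K$, totally positive units $\mathcal{U}_K^+$. $L/K$ is a quadratic extension, $\overline{\cdot}$ its nontrivial automorphism, $\mathcal{O}_L=\mathcal{O}_K+\mathcal{O}_K\Omega$, $[\alpha,\beta]=\mathcal{O}_K\alpha+\mathcal{O}_K\beta$, $\mathcal{D}=\{u^2(\Omega-\overline{\Omega})^2:u\in\mathcal{U}_K^+\}$, and $\sqrt{u^2(\Omega-\overline\Omega)^2}:=u(\Omega-\overline\Omega)$ for $u\in\mathcal{U}_K^+$. Quadratic forms $ax^2+bxy+cy^2$ have coefficients in $\mathcal{O}_K$; primitive means $\gcd(a,b,c)$ is a unit; $Q\sim Q'$ if $Q'(x,y)=uQ(px+qy,rx+sy)$ with $p,q,r,s\in\mathcal{O}_K$, $ps-qr\in\mathcal{U}_K^+$, $u\in\mathcal{U}_K^+$. $\mathcal{QF}_{\mathcal{D}}$ is the set of classes of primitive forms with discriminant in $\mathcal{D}$. Oriented ideals are pairs $(I;\varepsilon_1,\dots,\varepsilon_r)$, $I$ a fractional $\mathcal{O}_L$-ideal,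 $\varepsilon_l\in\{\pm1\}$, multiplied componentwise; principal oriented ideals are $((\gamma);\operatorname{sgn}\sigma_1(\gamma\overline\gamma),\dots,\operatorname{sgn}\sigma_r(\gamma\overline\gamma))$, $\gamma\in L^\times$; $\mathrm{Cl}^+(L/K)$ is the quotient group. The map $\Psi:\mathcal{QF}_{\mathcal{D}}\to\mathrm{Cl}^+(L/K)$, $ax^2+bxy+cy^2\mapsto$ class of $\big([a,\tfrac{-b+\sqrt{b^2-4ac}}{2}];\operatorname{sgn}\sigma_1(a),\dots,\operatorname{sgn}\sigma_r(a)\big)$, is a (known) bijection, and $\mathcal{QF}_{\mathcal{D}}$ carries the group structure making $\Psi$ an isomorphism. Cubes: arrays $(a_{ijk})$ over $\mathcal{O}_K$; with $a=a_{111},b=a_{121},c=a_{112},d=a_{122},e=a_{211},f=a_{221},g=a_{212},h=a_{222}$, the attached forms are $Q_1=(bc-ad)x^2+(ah-bg-cf+de)xy+(fg-eh)y^2$, $Q_2=(ce-ag)x^2+(ah+bg-cf-de)xy+(df-bh)y^2$, $Q_3=(be-af)x^2+(ah-bg+cf-de)xy+(dg-ch)y^2$, of common discriminant $\operatorname{Disc}(A)$; $A$ is projective if all three are primitive.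
   Formalization: It is assumed that K has at least one real embedding (r ≥ 1); for totally imaginary K both u and −u are totally positive units, so the prescribed square root, and with it Ψ and the group structure on QF_D, is not well defined. *)

theory Defs
  imports Complex_Main "HOL-Computational_Algebra.Polynomial" "HOL-Library.FuncSet"
    "HOL-Algebra.Coset"
begin

text \<open>
  The field \<open>L\<close> is the whole type \<open>'a\<close>, and \<open>K\<close> is a subfield of it, given as a set. The relative
  conjugation of \<open>L/K\<close> is a function \<open>cj\<close>, and \<open>\<omega>\<close> stands for \<open>\<Omega>\<close>.
\<close>

subsection \<open>Number fields, real embeddings, integers and units\<close>

definition is_subfield :: "'a::field_char_0 set \<Rightarrow> bool" where
  "is_subfield K \<longleftrightarrow> 0 \<in> K \<and> 1 \<in> K \<and>
     (\<forall>x\<in>K. \<forall>y\<in>K. x + y \<in> K \<and> x * y \<in> K) \<and>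
     (\<forall>x\<in>K. - x \<in> K \<and> inverse x \<in> K)"

definition is_number_field :: "'a::field_char_0 set \<Rightarrow> bool" where
  "is_number_field K \<longleftrightarrow> is_subfield K \<and>
     (\<exists>B. finite B \<and> B \<subseteq> K \<and>
        (\<forall>x\<in>K. \<exists>q :: 'a \<Rightarrow> rat. x = (\<Sum>b\<in>B. of_rat (q b) * b)))"

definition is_quadratic_extension :: "'a::field_char_0 set \<Rightarrow> bool" where
  "is_quadratic_extension K \<longleftrightarrow>
     (\<exists>\<alpha> \<beta>. \<forall>z. \<exists>!p. p \<in> K \<times> K \<and> z = fst p * \<alpha> + snd p * \<beta>)"

definition is_nontrivial_automorphism ::
    "'a::field_char_0 set \<Rightarrow> ('a \<Rightarrow> 'a) \<Rightarrow> bool" where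
  "is_nontrivial_automorphism K cj \<longleftrightarrow> bij cj \<and>
     (\<forall>x y. cj (x + y) = cj x + cj y) \<and> (\<forall>x y. cj (x * y) = cj x * cj y) \<and>
     (\<forall>x\<in>K. cj x = x) \<and> cj \<noteq> id"

text \<open>
  Extensionality outside \<open>K\<close> makes each embedding \<open>K \<rightarrow> \<real>\<close> correspond to exactly one function.
\<close>

definition real_embeddings :: "'a::field_char_0 set \<Rightarrow> ('a \<Rightarrow> real) set" where
  "real_embeddings K = {\<sigma> \<in> extensional K. \<sigma> 1 = 1 \<and>
     (\<forall>x\<in>K. \<forall>y\<in>K. \<sigma> (x + y) = \<sigma> x + \<sigma> y \<and> \<sigma> (x * y) = \<sigma> x * \<sigma> y)}"

definition totally_positive :: "'a::field_char_0 set \<Rightarrow> 'a \<Rightarrow> bool" where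
  "totally_positive K x \<longleftrightarrow> x \<in> K \<and> x \<noteq> 0 \<and> (\<forall>\<sigma>\<in>real_embeddings K. \<sigma> x > 0)"

definition integers_of :: "'a::field_char_0 set \<Rightarrow> 'a set" where
  "integers_of F = {x \<in> F. algebraic_int x}"

definition unit_set :: "'a::field_char_0 set \<Rightarrow> 'a set" where
  "unit_set K = {u \<in> integers_of K. \<exists>v\<in>integers_of K. u * v = 1}"

definition pos_unit_set :: "'a::field_char_0 set \<Rightarrow> 'a set" where
  "pos_unit_set K = {u \<in> unit_set K. totally_positive K u}"

subsection \<open>Fractional ideals and the narrow class number\<close>

definition fractional_ideals :: "'a::field_char_0 set \<Rightarrow> 'a set set" where
  "fractional_ideals F = {I. I \<subseteq> F \<and> 0 \<in> I \<and> I \<noteq> {0} \<and>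
     (\<forall>x\<in>I. \<forall>y\<in>I. x + y \<in> I) \<and> (\<forall>r\<in>integers_of F. \<forall>x\<in>I. r * x \<in> I) \<and>
     (\<exists>d\<in>integers_of F. d \<noteq> 0 \<and> (\<forall>x\<in>I. d * x \<in> integers_of F))}"

definition ideal_mult :: "'a::field_char_0 set \<Rightarrow> 'a set \<Rightarrow> 'a set" where
  "ideal_mult I J =
     {(\<Sum>i<n. x i * y i) | (n::nat) x y. \<forall>i<n. x i \<in> I \<and> y i \<in> J}"

definition principal_ideal :: "'a::field_char_0 set \<Rightarrow> 'a \<Rightarrow> 'a set" where
  "principal_ideal F \<gamma> = {r * \<gamma> | r. r \<in> integers_of F}"

definition ideal_group :: "'a::field_char_0 set \<Rightarrow> 'a set monoid" where
  "ideal_group F =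
     \<lparr>carrier = fractional_ideals F, mult = ideal_mult, one = integers_of F\<rparr>"

definition narrow_class_group :: "'a::field_char_0 set \<Rightarrow> 'a set set monoid" where
  "narrow_class_group K =
     ideal_group K Mod {principal_ideal K \<gamma> | \<gamma>. totally_positive K \<gamma>}"

definition narrow_class_number :: "'a::field_char_0 set \<Rightarrow> nat" where
  "narrow_class_number K = card (carrier (narrow_class_group K))"

subsection \<open>The relative oriented class group\<close>

text \<open>The signs of an oriented ideal are indexed by the real embeddings of \<open>K\<close> themselves.\<close>

type_synonym 'a oriented_ideal = "'a set \<times> (('a \<Rightarrow> real) \<Rightarrow> real)"

definition sign_vector :: "'a::field_char_0 set \<Rightarrow> 'a \<Rightarrow> ('a \<Rightarrow> real) \<Rightarrow> real" where
  "sign_vector K a = (\<lambda>\<sigma>\<in>real_embeddings K. sgn (\<sigma> a))"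

definition oriented_ideal_group :: "'a::field_char_0 set \<Rightarrow> 'a oriented_ideal monoid" where
  "oriented_ideal_group K =
     \<lparr>carrier = fractional_ideals UNIV \<times> (real_embeddings K \<rightarrow>\<^sub>E {1, -1}),
      mult = (\<lambda>(I, \<epsilon>) (J, \<delta>). (ideal_mult I J, \<lambda>\<sigma>\<in>real_embeddings K. \<epsilon> \<sigma> * \<delta> \<sigma>)),
      one = (integers_of UNIV, \<lambda>\<sigma>\<in>real_embeddings K. 1)\<rparr>"

definition principal_oriented_ideals ::
    "'a::field_char_0 set \<Rightarrow> ('a \<Rightarrow> 'a) \<Rightarrow> 'a oriented_ideal set" where
  "principal_oriented_ideals K cj =
     {(principal_ideal UNIV \<gamma>, sign_vector K (\<gamma> * cj \<gamma>)) | \<gamma>. \<gamma> \<noteq> 0}"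

definition relative_class_group ::
    "'a::field_char_0 set \<Rightarrow> ('a \<Rightarrow> 'a) \<Rightarrow> 'a oriented_ideal set monoid" where
  "relative_class_group K cj = oriented_ideal_group K Mod principal_oriented_ideals K cj"

subsection \<open>Binary quadratic forms\<close>

text \<open>The triple \<open>(a, b, c)\<close> is the form \<open>ax\<^sup>2 + bxy + cy\<^sup>2\<close>.\<close>

type_synonym 'a form = "'a \<times> 'a \<times> 'a"

fun form_eval :: "'a::field_char_0 form \<Rightarrow> 'a \<Rightarrow> 'a \<Rightarrow> 'a" where
  "form_eval (a, b, c) x y = a * x^2 + b * x * y + c * y^2"

fun form_disc :: "'a::field_char_0 form \<Rightarrow> 'a" where
  "form_disc (a, b, c) = b^2 - 4 * a * c"

fun integral_form :: "'a::field_char_0 set \<Rightarrow> 'a form \<Rightarrow> bool" where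
  "integral_form K (a, b, c) \<longleftrightarrow>
     a \<in> integers_of K \<and> b \<in> integers_of K \<and> c \<in> integers_of K"

definition int_dvd :: "'a::field_char_0 set \<Rightarrow> 'a \<Rightarrow> 'a \<Rightarrow> bool" where
  "int_dvd K d x \<longleftrightarrow> (\<exists>k\<in>integers_of K. x = d * k)"

fun primitive_form :: "'a::field_char_0 set \<Rightarrow> 'a form \<Rightarrow> bool" where
  "primitive_form K (a, b, c) \<longleftrightarrow>
     (\<forall>d\<in>integers_of K. int_dvd K d a \<and> int_dvd K d b \<and> int_dvd K d c \<longrightarrow> d \<in> unit_set K)"

definition disc_set :: "'a::field_char_0 set \<Rightarrow> ('a \<Rightarrow> 'a) \<Rightarrow> 'a \<Rightarrow> 'a set" where
  "disc_set K cj \<omega> = {u^2 * (\<omega> - cj \<omega>)^2 | u. u \<in> pos_unit_set K}"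

text \<open>
  The description below determines a unique element only if \<open>K\<close> has a real embedding; otherwise
  \<open>u\<close> and \<open>- u\<close> are both totally positive.
\<close>

definition disc_sqrt :: "'a::field_char_0 set \<Rightarrow> ('a \<Rightarrow> 'a) \<Rightarrow> 'a \<Rightarrow> 'a \<Rightarrow> 'a" where
  "disc_sqrt K cj \<omega> D =
     (THE s. \<exists>u\<in>pos_unit_set K. D = u^2 * (\<omega> - cj \<omega>)^2 \<and> s = u * (\<omega> - cj \<omega>))"

definition forms_with_disc ::
    "'a::field_char_0 set \<Rightarrow> ('a \<Rightarrow> 'a) \<Rightarrow> 'a \<Rightarrow> 'a form set" where
  "forms_with_disc K cj \<omega> =
     {Q. integral_form K Q \<and> primitive_form K Q \<and> form_disc Q \<in> disc_set K cj \<omega>}"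

definition form_equiv :: "'a::field_char_0 set \<Rightarrow> 'a form \<Rightarrow> 'a form \<Rightarrow> bool" where
  "form_equiv K Q Q' \<longleftrightarrow>
     (\<exists>p\<in>integers_of K. \<exists>q\<in>integers_of K. \<exists>r\<in>integers_of K. \<exists>s\<in>integers_of K.
        \<exists>u\<in>pos_unit_set K. p * s - q * r \<in> pos_unit_set K \<and>
          (\<forall>x\<in>K. \<forall>y\<in>K. form_eval Q' x y = u * form_eval Q (p * x + q * y) (r * x + s * y)))"

definition form_rel ::
    "'a::field_char_0 set \<Rightarrow> ('a \<Rightarrow> 'a) \<Rightarrow> 'a \<Rightarrow> ('a form \<times> 'a form) set" where
  "form_rel K cj \<omega> = {(Q, Q'). Q \<in> forms_with_disc K cj \<omega> \<and>
     Q' \<in> forms_with_disc K cj \<omega> \<and> form_equiv K Q Q'}"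

definition form_class ::
    "'a::field_char_0 set \<Rightarrow> ('a \<Rightarrow> 'a) \<Rightarrow> 'a \<Rightarrow> 'a form \<Rightarrow> 'a form set" where
  "form_class K cj \<omega> Q = form_rel K cj \<omega> `` {Q}"

definition QF :: "'a::field_char_0 set \<Rightarrow> ('a \<Rightarrow> 'a) \<Rightarrow> 'a \<Rightarrow> 'a form set set" where
  "QF K cj \<omega> = forms_with_disc K cj \<omega> // form_rel K cj \<omega>"

subsection \<open>The bijection with the class group and the composition of forms\<close>

definition span2 :: "'a::field_char_0 set \<Rightarrow> 'a \<Rightarrow> 'a \<Rightarrow> 'a set" where
  "span2 K \<alpha> \<beta> = {x * \<alpha> + y * \<beta> | x y. x \<in> integers_of K \<and> y \<in> integers_of K}"

fun form_ideal ::
    "'a::field_char_0 set \<Rightarrow> ('a \<Rightarrow> 'a) \<Rightarrow> 'a \<Rightarrow> 'a form \<Rightarrow> 'a oriented_ideal" where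
  "form_ideal K cj \<omega> (a, b, c) =
     (span2 K a ((- b + disc_sqrt K cj \<omega> (b^2 - 4 * a * c)) / 2), sign_vector K a)"

definition form_ideal_class ::
    "'a::field_char_0 set \<Rightarrow> ('a \<Rightarrow> 'a) \<Rightarrow> 'a \<Rightarrow> 'a form \<Rightarrow> 'a oriented_ideal set" where
  "form_ideal_class K cj \<omega> Q =
     principal_oriented_ideals K cj #>\<^bsub>oriented_ideal_group K\<^esub> form_ideal K cj \<omega> Q"

text \<open>
  The oriented ideal class does not depend on the representative of a class of forms, so that the
  image in the next definition is a singleton.
\<close>

definition Psi ::
    "'a::field_char_0 set \<Rightarrow> ('a \<Rightarrow> 'a) \<Rightarrow> 'a \<Rightarrow> 'a form set \<Rightarrow> 'a oriented_ideal set" where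
  "Psi K cj \<omega> C = the_elem (form_ideal_class K cj \<omega> ` C)"

text \<open>The group structure on \<open>QF\<close> is transported from the class group along \<open>Psi\<close>.\<close>

definition QF_group ::
    "'a::field_char_0 set \<Rightarrow> ('a \<Rightarrow> 'a) \<Rightarrow> 'a \<Rightarrow> 'a form set monoid" where
  "QF_group K cj \<omega> =
     \<lparr>carrier = QF K cj \<omega>,
      mult = (\<lambda>X Y. the_inv_into (QF K cj \<omega>) (Psi K cj \<omega>)
                (Psi K cj \<omega> X \<otimes>\<^bsub>relative_class_group K cj\<^esub> Psi K cj \<omega> Y)),
      one = the_inv_into (QF K cj \<omega>) (Psi K cj \<omega>) \<one>\<^bsub>relative_class_group K cj\<^esub>\<rparr>"

subsection \<open>Cubes\<close>

text \<open>The entry \<open>a\<^sub>i\<^sub>j\<^sub>k\<close> is \<open>A i j k\<close>, with indices in \<open>{1, 2}\<close>.\<close>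

type_synonym 'a cube = "nat \<Rightarrow> nat \<Rightarrow> nat \<Rightarrow> 'a"

definition integral_cube :: "'a::field_char_0 set \<Rightarrow> 'a cube \<Rightarrow> bool" where
  "integral_cube K A \<longleftrightarrow>
     (\<forall>i\<in>{1, 2}. \<forall>j\<in>{1, 2}. \<forall>k\<in>{1, 2}. A i j k \<in> integers_of K)"

definition cube_form1 :: "'a::field_char_0 cube \<Rightarrow> 'a form" where
  "cube_form1 A =
     (let a = A 1 1 1; b = A 1 2 1; c = A 1 1 2; d = A 1 2 2;
          e = A 2 1 1; f = A 2 2 1; g = A 2 1 2; h = A 2 2 2
      in (b * c - a * d, a * h - b * g - c * f + d * e, f * g - e * h))"

definition cube_form2 :: "'a::field_char_0 cube \<Rightarrow> 'a form" where
  "cube_form2 A =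
     (let a = A 1 1 1; b = A 1 2 1; c = A 1 1 2; d = A 1 2 2;
          e = A 2 1 1; f = A 2 2 1; g = A 2 1 2; h = A 2 2 2
      in (c * e - a * g, a * h + b * g - c * f - d * e, d * f - b * h))"

definition cube_form3 :: "'a::field_char_0 cube \<Rightarrow> 'a form" where
  "cube_form3 A =
     (let a = A 1 1 1; b = A 1 2 1; c = A 1 1 2; d = A 1 2 2;
          e = A 2 1 1; f = A 2 2 1; g = A 2 1 2; h = A 2 2 2
      in (b * e - a * f, a * h - b * g + c * f - d * e, d * g - c * h))"

definition cube_disc :: "'a::field_char_0 cube \<Rightarrow> 'a" where
  "cube_disc A = form_disc (cube_form1 A)"

lemma form_disc_cube_form:
  "form_disc (cube_form1 A) = cube_disc A"
  "form_disc (cube_form2 A) = cube_disc A"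
  "form_disc (cube_form3 A) = cube_disc A"
  by (simp_all add: cube_disc_def cube_form1_def cube_form2_def cube_form3_def Let_def
        power2_eq_square algebra_simps)

definition projective_cube :: "'a::field_char_0 set \<Rightarrow> 'a cube \<Rightarrow> bool" where
  "projective_cube K A \<longleftrightarrow> primitive_form K (cube_form1 A) \<and>
     primitive_form K (cube_form2 A) \<and> primitive_form K (cube_form3 A)"

end

theory Submission
  imports Defs "Jordan_Normal_Form.Char_Poly"
begin

text \<open>
  Write \<open>s = u (\<Omega> - cj \<Omega>)\<close> for the common root of the discriminants, and attach to a form
  \<open>(a, b, c)\<close> the module \<open>I = [a, \<theta>]\<close> with \<open>\<theta> = (- b + s) / 2\<close>. Primitivity gives
  \<open>I * cj I = (a)\<close>, and the identity \<open>a Q(x, y) = (a x - \<theta> y) (a x - cj \<theta> y)\<close> shows that two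
  forms are equivalent iff their oriented modules differ by a principal one; hence \<open>Psi\<close> is well
  defined and injective. For the three modules of a cube, all products of generators are multiples
  of \<open>\<kappa> = a\<^sub>2\<^sub>1\<^sub>1 a\<^sub>1 - a\<^sub>1\<^sub>1\<^sub>1 \<theta>\<^sub>1\<close>, where \<open>a\<^sub>i\<close> is the leading coefficient of the \<open>i\<close>-th form, and
  \<open>\<kappa>\<close> has norm \<open>a\<^sub>1 a\<^sub>2 a\<^sub>3\<close>. Comparing \<open>J = I\<^sub>1 I\<^sub>2 I\<^sub>3\<close>, which lies in \<open>(\<kappa>)\<close>, with
  \<open>J * cj J = (a\<^sub>1 a\<^sub>2 a\<^sub>3) = (\<kappa> * cj \<kappa>)\<close> yields \<open>J = (\<kappa>)\<close> with the right signs.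

  The composition of the first two forms can be computed with injectivity of \<open>Psi\<close> alone, because
  \<open>I\<^sub>1 I\<^sub>2\<close> is in the class of \<open>cj I\<^sub>3\<close>, which comes from the form \<open>(a\<^sub>3, - b\<^sub>3, c\<^sub>3)\<close>.
\<close>

section \<open>Algebraic integers\<close>

text \<open>Makes \<open>zmod.span B\<close> the additive subgroup generated by \<open>B\<close>, so
  that the library facts on spans apply to finitely generated subgroups of a field.\<close>

interpretation zmod: Modules.module "\<lambda>(n::int) (x::'a::field_char_0). of_int n * x"
  by unfold_locales (simp_all add: algebra_simps)

text \<open>The determinant trick: the vector of the \<open>f i\<close> is an eigenvector of an
  integer matrix for the eigenvalue \<open>y\<close>, so \<open>y\<close> is a root of the
  characteristic polynomial, which is monic with integer coefficients.\<close>

lemma algebraic_int_eigenvalue: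
  fixes y :: "'a::field_char_0" and f :: "nat \<Rightarrow> 'a" and m :: "nat \<Rightarrow> nat \<Rightarrow> int"
  assumes "\<And>i. i < n \<Longrightarrow> y * f i = (\<Sum>j<n. of_int (m i j) * f j)"
    and "k < n" and "f k \<noteq> 0"
  shows "algebraic_int y"
proof -
  define M where "M = Matrix.mat n n (\<lambda>(i, j). m i j)"
  define M' where "M' = (map_mat of_int M :: 'a Matrix.mat)"
  have M: "M \<in> carrier_mat n n" and M': "M' \<in> carrier_mat n n"
    by (auto simp: M_def M'_def)
  have "eigenvector M' (Matrix.vec n f) y"
    unfolding eigenvector_def
  proof (intro conjI)
    show "Matrix.vec n f \<in> carrier_vec (dim_row M')"
      using M' by auto
    have "Matrix.vec n f $ k \<noteq> 0\<^sub>v n $ k"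
      using assms by auto
    then show "Matrix.vec n f \<noteq> 0\<^sub>v (dim_row M')"
      using M' by auto
    show "M' *\<^sub>v Matrix.vec n f = y \<cdot>\<^sub>v Matrix.vec n f"
      using assms(1) by (intro eq_vecI)
        (auto simp: M'_def M_def scalar_prod_def lessThan_atLeast0)
  qed
  then have "poly (char_poly M') y = 0"
    using eigenvalue_root_char_poly[OF M'] by (auto simp: eigenvalue_def)
  moreover have "char_poly M' = map_poly of_int (char_poly M)"
    unfolding M'_def by (rule of_int_hom.char_poly_hom[OF M])
  moreover have "lead_coeff (char_poly M) = 1"
    using degree_monic_char_poly[OF M] by simp
  ultimately show ?thesis
    by (auto simp: algebraic_int_altdef_ipoly)
qed

text \<open>Writing each \<open>y * b\<close> as an integer combination of an enumeration of
  \<open>B\<close> gives the matrix for the determinant trick; \<open>b0\<close> ensures that the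
  eigenvector is nonzero.\<close>

lemma algebraic_int_if_stable:
  fixes y :: "'a::field_char_0"
  assumes "finite B" and "b0 \<in> B" "b0 \<noteq> 0"
    and "\<And>b. b \<in> B \<Longrightarrow> y * b \<in> zmod.span B"
  shows "algebraic_int y"
proof -
  obtain f where f: "bij_betw f {..<card B} B"
    using ex_bij_betw_nat_finite[OF assms(1)] by (auto simp: lessThan_atLeast0)
  have "\<exists>c. y * f i = (\<Sum>j<card B. of_int (c j) * f j)" if "i < card B" for i
  proof -
    have "y * f i \<in> zmod.span B"
      using f that by (intro assms(4)) (auto simp: bij_betw_def)
    then obtain c :: "'a \<Rightarrow> int" where "y * f i = (\<Sum>b\<in>B. of_int (c b) * b)"
      by (auto simp: zmod.span_finite[OF assms(1)])
    also have "\<dots> = (\<Sum>j<card B. of_int (c (f j)) * f j)"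
      by (rule sum.reindex_bij_betw[OF f, symmetric])
    finally show ?thesis by (intro exI[of _ "\<lambda>j. c (f j)"])
  qed
  then obtain m where "\<And>i. i < card B \<Longrightarrow> y * f i = (\<Sum>j<card B. of_int (m i j) * f j)"
    by metis
  moreover obtain k where "k < card B" "f k = b0"
    using f assms(2) by (metis bij_betw_imp_surj_on imageE lessThan_iff)
  ultimately show ?thesis
    using assms(3) by (intro algebraic_int_eigenvalue[of "card B" y f m k]) auto
qed

section \<open>Stable finitely generated groups and the ring of algebraic integers\<close>

text \<open>For fixed \<open>B\<close> these elements form a ring. Sums and products of algebraic
  integers are therefore handled by finding one finite \<open>B\<close> whose span is stable under
  both.\<close>

definition stabilizes :: "'a::field_char_0 \<Rightarrow> 'a set \<Rightarrow> bool" where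
  "stabilizes y B \<longleftrightarrow> (\<forall>x\<in>zmod.span B. y * x \<in> zmod.span B)"

lemma stabilizes_intro:
  assumes "\<And>b. b \<in> B \<Longrightarrow> y * b \<in> zmod.span B"
  shows "stabilizes y B"
  unfolding stabilizes_def
proof
  fix x assume "x \<in> zmod.span B"
  then show "y * x \<in> zmod.span B"
  proof (induction rule: zmod.span_induct_alt)
    case (step c x z)
    then show ?case
      using zmod.span_add[OF zmod.span_scale[OF assms[OF step(1)], of c] step(2)]
      by (simp add: algebra_simps)
  qed (simp add: zmod.span_zero)
qed

lemma stabilizes_add: "stabilizes x B \<Longrightarrow> stabilizes y B \<Longrightarrow> stabilizes (x + y) B"
  unfolding stabilizes_def by (simp add: distrib_right zmod.span_add)

lemma stabilizes_mult: "stabilizes x B \<Longrightarrow> stabilizes y B \<Longrightarrow> stabilizes (x * y) B"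
  unfolding stabilizes_def by (simp add: mult.assoc)

lemma stabilizes_minus: "stabilizes x B \<Longrightarrow> stabilizes (- x) B"
  unfolding stabilizes_def by (simp add: zmod.span_neg)

lemma stabilizes_Ints: "x \<in> \<int> \<Longrightarrow> stabilizes x B"
  unfolding stabilizes_def by (auto elim!: Ints_cases intro: zmod.span_scale)

text \<open>Take for \<open>B'\<close> all products \<open>b * y ^ i\<close> with
  \<open>i < n\<close>; the monic relation brings \<open>y ^ n\<close> back into their span. The
  coefficients are only asked to stabilize the span of \<open>B\<close>, so the lemma covers
  elements that are integral over algebraic integers as well as over \<int>.\<close>

lemma adjoin_integral:
  fixes y :: "'a::field_char_0"
  assumes "finite B" "1 \<in> B"
    and y: "y ^ n = (\<Sum>i<n. c i * y ^ i)"
    and c: "\<And>i. i < n \<Longrightarrow> stabilizes (c i) B"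
  obtains B' where "finite B'" "1 \<in> B'" "stabilizes y B'"
    "\<And>s. stabilizes s B \<Longrightarrow> stabilizes s B'"
proof -
  define B' where "B' = (\<lambda>(b, i). b * y ^ i) ` (B \<times> {..<n})"
  \<comment> \<open>For \<open>n = 0\<close> the relation would read \<open>1 = 0\<close>;
    positivity puts the power \<open>y ^ 0\<close>, and hence 1, within reach of
    \<open>B'\<close>.\<close>
  have n: "n > 0"
    using y by (intro gr0I) auto
  have span: "x * y ^ i \<in> zmod.span B'" if "x \<in> zmod.span B" "i < n" for x i
    using that(1)
  proof (induction rule: zmod.span_induct_alt)
    case (step k b z)
    have "b * y ^ i \<in> zmod.span B'"
      using step(1) that(2) by (intro zmod.span_base) (auto simp: B'_def)
    then show ?case
      using zmod.span_add[OF zmod.span_scale[of "b * y ^ i" B' k] step(2)]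
      by (simp add: algebra_simps)
  qed (simp add: zmod.span_zero)
  show thesis
  proof
    show "finite B'"
      using assms(1) by (simp add: B'_def)
    show "1 \<in> B'"
      using assms(2) n by (force simp: B'_def)
    show "stabilizes s B'" if "stabilizes s B" for s
    proof (rule stabilizes_intro)
      fix z assume "z \<in> B'"
      then obtain b i where z: "z = b * y ^ i" "b \<in> B" "i < n"
        by (auto simp: B'_def)
      then have "s * b \<in> zmod.span B"
        using that by (auto simp: stabilizes_def zmod.span_base)
      then show "s * z \<in> zmod.span B'"
        using span[of "s * b" i] z by (simp add: mult.assoc)
    qed
    show "stabilizes y B'"
    proof (rule stabilizes_intro)
      fix z assume "z \<in> B'"
      then obtain b i where z: "z = b * y ^ i" "b \<in> B" "i < n"
        by (auto simp: B'_def)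
      have yz: "y * z = b * y ^ Suc i"
        using z by simp
      show "y * z \<in> zmod.span B'"
      proof (cases "Suc i < n")
        case True
        then show ?thesis
          unfolding yz using z by (intro span zmod.span_base)
      next
        case False
        then have "Suc i = n"
          using z by simp
        then have "y * z = (\<Sum>i<n. (c i * b) * y ^ i)"
          unfolding yz by (simp add: y sum_distrib_left mult_ac)
        also have "\<dots> \<in> zmod.span B'"
          using c z by (intro zmod.span_sum span) (auto simp: stabilizes_def zmod.span_base)
        finally show ?thesis .
      qed
    qed
  qed
qed

text \<open>The relation comes from a monic integer polynomial, whose coefficients stabilize any
  span. Earlier stabilizers are kept, so that several elements can be adjoined in turn.\<close>

lemma adjoin_algebraic_int:
  fixes y :: "'a::field_char_0"
  assumes "finite B" "1 \<in> B" "algebraic_int y"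
  obtains B' where "finite B'" "1 \<in> B'" "stabilizes y B'"
    "\<And>s. stabilizes s B \<Longrightarrow> stabilizes s B'"
proof -
  obtain p where p: "lead_coeff p = 1" "\<And>i. coeff p i \<in> \<int>" "poly p y = 0"
    using assms(3) by (auto elim: algebraic_int.cases)
  have "y ^ degree p = (\<Sum>i<degree p. (- coeff p i) * y ^ i)"
    using p by (simp add: poly_altdef lessThan_Suc_atMost[symmetric] sum_negf
        add_eq_0_iff)
  then show thesis
    using assms(1,2) p(2) that
    by (elim adjoin_integral[rotated 2]) (auto intro!: stabilizes_Ints)
qed

lemma algebraic_int_if_stabilizes:
  assumes "finite B" "1 \<in> B" "stabilizes y B"
  shows "algebraic_int y"
  using assms by (intro algebraic_int_if_stable[of B 1 y]) (auto simp: stabilizes_def zmod.span_base)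

text \<open>Starting from \<open>{1}\<close>, adjoin \<open>x\<close> and then \<open>y\<close>; the
  resulting span is stable under both, hence under sum and product.\<close>

lemma algebraic_int_add_mult:
  fixes x y :: "'a::field_char_0"
  assumes "algebraic_int x" "algebraic_int y"
  shows algebraic_int_add: "algebraic_int (x + y)"
    and algebraic_int_mult: "algebraic_int (x * y)"
proof -
  obtain B where B: "finite B" "1 \<in> B" "stabilizes x B"
    using adjoin_algebraic_int[of "{1}" x] assms by auto
  obtain B' where "finite B'" "1 \<in> B'" "stabilizes x B'" "stabilizes y B'"
    using adjoin_algebraic_int[OF B(1,2) assms(2)] B(3) by metis
  then show "algebraic_int (x + y)" "algebraic_int (x * y)"
    by (auto intro: algebraic_int_if_stabilizes stabilizes_add stabilizes_mult)
qed

text \<open>Transitivity of integrality in degree two: after \<open>b\<close> and \<open>c\<close>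
  have been adjoined, the quadratic relation permits adjoining \<open>z\<close>.\<close>

lemma algebraic_int_quadratic:
  fixes z :: "'a::field_char_0"
  assumes "algebraic_int b" "algebraic_int c" and z: "z\<^sup>2 + b * z + c = 0"
  shows "algebraic_int z"
proof -
  obtain B where B: "finite B" "1 \<in> B" "stabilizes b B"
    using adjoin_algebraic_int[of "{1}" b] assms by auto
  obtain B' where B': "finite B'" "1 \<in> B'" "stabilizes b B'" "stabilizes c B'"
    using adjoin_algebraic_int[OF B(1,2) assms(2)] B(3) by metis
  have "z ^ 2 = (\<Sum>i<2. (if i = 0 then - c else - b) * z ^ i)"
    using z by (simp add: numeral_2_eq_2 lessThan_Suc algebra_simps eq_neg_iff_add_eq_0)
  then obtain B'' where "finite B''" "1 \<in> B''" "stabilizes z B''"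
    using B' by (elim adjoin_integral[OF B'(1,2)]) (auto intro: stabilizes_minus)
  then show ?thesis
    by (rule algebraic_int_if_stabilizes)
qed

section \<open>Quadratic extensions of number fields\<close>

lemma common_denominator:
  assumes "finite (S :: rat set)"
  shows "\<exists>N::int. N > 0 \<and> (\<forall>q\<in>S. of_int N * q \<in> \<int>)"
  using assms
proof induction
  case (insert q S)
  then obtain N :: int where N: "N > 0" "\<forall>q\<in>S. of_int N * q \<in> \<int>"
    by auto
  obtain a b where ab: "b > 0" "q = of_int a / of_int b"
    using quotient_of_div[of q] quotient_of_denom_pos[of q] by (metis surj_pair)
  have "of_int b * q \<in> \<int>"
    using ab by simp
  then have "of_int (b * N) * r \<in> \<int>" if "r \<in> insert q S" for r
    using N that Ints_mult[of "of_int N" "of_int b * q"] Ints_mult[of "of_int b" "of_int N * r"]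
    by (auto simp: mult_ac)
  then show ?case
    using N ab by (intro exI[of _ "b * N"]) auto
qed (auto intro: exI[of _ 1])

text \<open>Multiplication by \<open>z\<close> acts on a finite rational generating set through a
  rational matrix. A common denominator \<open>N\<close> of its entries makes \<open>N * z\<close>
  preserve the additive group generated by that set.\<close>

lemma number_field_denominator:
  assumes "is_number_field K" and "z \<in> K"
  shows "\<exists>N::int. N > 0 \<and> algebraic_int (of_int N * z)"
proof -
  obtain B where B: "finite B" "B \<subseteq> K"
    "\<And>x. x \<in> K \<Longrightarrow> \<exists>q :: 'a \<Rightarrow> rat. x = (\<Sum>b\<in>B. of_rat (q b) * b)"
    using assms(1) unfolding is_number_field_def by auto
  have sub: "is_subfield K"
    using assms(1) by (simp add: is_number_field_def)
  have "1 \<in> K" and zb: "z * b \<in> K" if "b \<in> B" for b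
    using sub assms(2) B(2) that by (auto simp: is_subfield_def)
  obtain q :: "'a \<Rightarrow> 'a \<Rightarrow> rat" where q: "\<And>b. b \<in> B \<Longrightarrow> z * b = (\<Sum>c\<in>B. of_rat (q b c) * c)"
    using B(3)[OF zb] by metis
  obtain N :: int where N: "N > 0" "\<And>b c. b \<in> B \<Longrightarrow> c \<in> B \<Longrightarrow> of_int N * q b c \<in> \<int>"
    using common_denominator[of "(\<lambda>(b, c). q b c) ` (B \<times> B)"] B(1) by auto
  have "\<exists>b\<in>B. b \<noteq> 0"
  proof (rule ccontr)
    assume "\<not> ?thesis"
    then have "x = 0" if "x \<in> K" for x
      using B(3)[OF that] by (auto intro: sum.neutral)
    from this[of 1] show False
      using sub by (simp add: is_subfield_def)
  qed
  then obtain b0 where b0: "b0 \<in> B" "b0 \<noteq> 0" by auto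
  have "of_int N * z * b \<in> zmod.span B" if b: "b \<in> B" for b
  proof -
    have "of_rat (of_int N * q b c) * c \<in> zmod.span B" if "c \<in> B" for c
    proof -
      obtain m where "of_int N * q b c = of_int m"
        using N(2)[OF b \<open>c \<in> B\<close>] by (auto elim: Ints_cases)
      then show ?thesis
        using that by (auto intro: zmod.span_scale zmod.span_base)
    qed
    then have "(\<Sum>c\<in>B. of_rat (of_int N * q b c) * c) \<in> zmod.span B"
      by (intro zmod.span_sum)
    also have "(\<Sum>c\<in>B. of_rat (of_int N * q b c) * c) = of_int N * z * b"
      by (simp add: q[OF b] of_rat_mult sum_distrib_left mult.assoc)
    finally show ?thesis .
  qed
  then have "algebraic_int (of_int N * z)"
    using algebraic_int_if_stable[OF B(1) b0] by blast
  then show ?thesis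
    using N by blast
qed

text \<open>Cayley-Hamilton for multiplication by \<open>z\<close> on the basis \<alpha>, \<beta>:
  the polynomial has trace \<open>p + s\<close> and determinant \<open>p * s - q * r\<close>, and
  its value at \<open>z\<close> annihilates both basis elements, one of which is nonzero.\<close>

lemma quadratic_extension_root:
  fixes K :: "'a::field_char_0 set" and z :: 'a
  assumes K: "is_subfield K" and "is_quadratic_extension K"
  obtains b c where "b \<in> K" "c \<in> K" "z\<^sup>2 + b * z + c = 0"
proof -
  obtain \<alpha> \<beta> where ab: "\<And>z. \<exists>!p. p \<in> K \<times> K \<and> z = fst p * \<alpha> + snd p * \<beta>"
    using assms(2) unfolding is_quadratic_extension_def by auto
  have ab: "\<exists>p q. p \<in> K \<and> q \<in> K \<and> z = p * \<alpha> + q * \<beta>" for z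
    using ab[of z] by (auto simp: mem_Times_iff)
  obtain p q where p: "p \<in> K" "q \<in> K" "z * \<alpha> = p * \<alpha> + q * \<beta>"
    using ab by metis
  obtain r s where r: "r \<in> K" "s \<in> K" "z * \<beta> = r * \<alpha> + s * \<beta>"
    using ab by metis
  have nz: "\<alpha> \<noteq> 0 \<or> \<beta> \<noteq> 0"
    using ab[of 1] by auto
  have "(z\<^sup>2 + (- (p + s)) * z + (p * s + - (q * r))) * \<alpha>
      = (z - s) * (z * \<alpha> - p * \<alpha> - q * \<beta>) + q * (z * \<beta> - r * \<alpha> - s * \<beta>)"
    by (simp add: algebra_simps power2_eq_square)
  moreover have "(z\<^sup>2 + (- (p + s)) * z + (p * s + - (q * r))) * \<beta>
      = (z - p) * (z * \<beta> - r * \<alpha> - s * \<beta>) + r * (z * \<alpha> - p * \<alpha> - q * \<beta>)"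
    by (simp add: algebra_simps power2_eq_square)
  ultimately have "z\<^sup>2 + (- (p + s)) * z + (p * s + - (q * r)) = 0"
    using nz p(3) r(3) by auto
  moreover have "- (p + s) \<in> K" "p * s + - (q * r) \<in> K"
    using p r K unfolding is_subfield_def by blast+
  ultimately show thesis
    using that by blast
qed

lemma quadratic_extension_denominator:
  fixes K :: "'a::field_char_0 set" and z :: 'a
  assumes "is_number_field K" and "is_quadratic_extension K"
  shows "\<exists>N::int. N > 0 \<and> algebraic_int (of_int N * z)"
proof -
  obtain b c where bc: "b \<in> K" "c \<in> K" "z\<^sup>2 + b * z + c = 0"
    using quadratic_extension_root[of K z] assms by (auto simp: is_number_field_def)
  obtain M :: int where M: "M > 0" "algebraic_int (of_int M * b)"
    using number_field_denominator[OF assms(1) bc(1)] by auto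
  obtain N :: int where N: "N > 0" "algebraic_int (of_int N * c)"
    using number_field_denominator[OF assms(1) bc(2)] by auto
  have "algebraic_int (of_int N * (of_int M * b))" "algebraic_int (of_int (M * M * N) * (of_int N * c))"
    using M N by (blast intro: algebraic_int_mult)+
  \<comment> \<open>The quadratic equation of \<open>z\<close> times the square of
    \<open>M * N\<close>, with the powers distributed so that both coefficients are visibly
    integral.\<close>
  moreover have "(of_int (M * N) * z)\<^sup>2 + of_int N * (of_int M * b) * (of_int (M * N) * z)
      + of_int (M * M * N) * (of_int N * c) = 0"
    using bc(3) unfolding of_int_mult by Groebner_Basis.algebra
  ultimately have "algebraic_int (of_int (M * N) * z)"
    by (rule algebraic_int_quadratic)
  then show ?thesis
    using M N by (intro exI[of _ "M * N"]) auto
qed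

section \<open>Integers of the two fields and the conjugation\<close>

locale quadratic_order =
  fixes K :: "'a::field_char_0 set" and cj :: "'a \<Rightarrow> 'a" and \<omega> :: 'a
  assumes number_field: "is_number_field K"
    and real_place: "real_embeddings K \<noteq> {}"
    and narrow_class_number: "narrow_class_number K = 1"
    and quadratic: "is_quadratic_extension K"
    and automorphism: "is_nontrivial_automorphism K cj"
    and integral_basis: "integers_of UNIV = span2 K 1 \<omega>"
begin

abbreviation "OK \<equiv> integers_of K"
abbreviation "OL \<equiv> integers_of (UNIV :: 'a set)"

lemma K_closed [intro, simp]:
  shows K_0: "0 \<in> K" and K_1: "1 \<in> K"
    and K_add: "\<And>x y. x \<in> K \<Longrightarrow> y \<in> K \<Longrightarrow> x + y \<in> K"
    and K_mult: "\<And>x y. x \<in> K \<Longrightarrow> y \<in> K \<Longrightarrow> x * y \<in> K"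
    and K_minus: "\<And>x. x \<in> K \<Longrightarrow> - x \<in> K"
    and K_inverse: "\<And>x. x \<in> K \<Longrightarrow> inverse x \<in> K"
  using number_field by (auto simp: is_number_field_def is_subfield_def)

lemma K_diff [intro, simp]: "x \<in> K \<Longrightarrow> y \<in> K \<Longrightarrow> x - y \<in> K"
  using K_add[of x "- y"] by simp

lemma K_divide [intro, simp]: "x \<in> K \<Longrightarrow> y \<in> K \<Longrightarrow> x / y \<in> K"
  by (simp add: divide_inverse)

lemma K_of_int [intro, simp]: "of_int n \<in> K"
proof -
  have "of_nat n \<in> K" for n
    by (induction n) auto
  then show ?thesis
    by (cases n) (auto simp: simp del: of_nat_Suc)
qed

lemma K_numeral [intro, simp]: "numeral n \<in> K"
  using K_of_int[of "numeral n"] by simp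

lemma OK_iff: "x \<in> OK \<longleftrightarrow> x \<in> K \<and> algebraic_int x"
  by (simp add: integers_of_def)

lemma OL_iff: "x \<in> OL \<longleftrightarrow> algebraic_int x"
  by (simp add: integers_of_def)

lemma OK_closed [intro, simp]:
  shows OK_0: "0 \<in> OK" and OK_1: "1 \<in> OK"
    and OK_add: "\<And>x y. x \<in> OK \<Longrightarrow> y \<in> OK \<Longrightarrow> x + y \<in> OK"
    and OK_mult: "\<And>x y. x \<in> OK \<Longrightarrow> y \<in> OK \<Longrightarrow> x * y \<in> OK"
    and OK_minus: "\<And>x. x \<in> OK \<Longrightarrow> - x \<in> OK"
  by (auto simp: OK_iff algebraic_int_add algebraic_int_mult)

lemma OK_diff [intro, simp]: "x \<in> OK \<Longrightarrow> y \<in> OK \<Longrightarrow> x - y \<in> OK"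
  using OK_add[of x "- y"] by simp

lemma OL_closed [intro, simp]:
  shows OL_0: "0 \<in> OL" and OL_1: "1 \<in> OL"
    and OL_add: "\<And>x y. x \<in> OL \<Longrightarrow> y \<in> OL \<Longrightarrow> x + y \<in> OL"
    and OL_mult: "\<And>x y. x \<in> OL \<Longrightarrow> y \<in> OL \<Longrightarrow> x * y \<in> OL"
    and OL_minus: "\<And>x. x \<in> OL \<Longrightarrow> - x \<in> OL"
  by (auto simp: OL_iff algebraic_int_add algebraic_int_mult)

lemma OL_diff [intro, simp]: "x \<in> OL \<Longrightarrow> y \<in> OL \<Longrightarrow> x - y \<in> OL"
  using OL_add[of x "- y"] by simp

lemma OK_imp_K: "x \<in> OK \<Longrightarrow> x \<in> K"
  and OK_imp_OL: "x \<in> OK \<Longrightarrow> x \<in> OL"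
  and OK_if_OL: "x \<in> OL \<Longrightarrow> x \<in> K \<Longrightarrow> x \<in> OK"
  by (auto simp: OK_iff OL_iff)

lemma OL_basis:
  assumes "z \<in> OL"
  obtains x y where "x \<in> OK" "y \<in> OK" "z = x + y * \<omega>"
  using assms unfolding integral_basis span2_def by auto

lemma omega_OL: "\<omega> \<in> OL"
  unfolding integral_basis span2_def by (rule CollectI, rule exI[of _ 0], rule exI[of _ 1]) simp

text \<open>A multiple of \<open>z\<close> by a positive integer is integral, and the integral basis
  applies to it; dividing by that integer leaves coordinates in \<open>K\<close>.\<close>

lemma K_basis: obtains x y where "x \<in> K" "y \<in> K" "z = x + y * \<omega>"
proof -
  obtain N :: int where N: "N > 0" "algebraic_int (of_int N * z)"
    using quadratic_extension_denominator[OF number_field quadratic] by auto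
  then obtain x y where xy: "x \<in> OK" "y \<in> OK" "of_int N * z = x + y * \<omega>"
    using OL_basis by (auto simp: OL_iff)
  have "z = x / of_int N + y / of_int N * \<omega>"
    using xy(3) N(1) by (simp add: field_simps)
  then show thesis
    using that[of "x / of_int N" "y / of_int N"] xy by (simp add: OK_imp_K)
qed

lemma cj_add: "cj (x + y) = cj x + cj y"
  and cj_mult: "cj (x * y) = cj x * cj y"
  and cj_K: "x \<in> K \<Longrightarrow> cj x = x"
  using automorphism by (auto simp: is_nontrivial_automorphism_def)

lemma cj_0: "cj 0 = 0" and cj_1: "cj 1 = 1"
  by (simp_all add: cj_K)

lemma cj_minus: "cj (- x) = - cj x"
  using cj_add[of x "- x"] by (simp add: cj_0 eq_neg_iff_add_eq_0 add.commute)

lemma cj_diff: "cj (x - y) = cj x - cj y"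
  using cj_add[of x "- y"] by (simp add: cj_minus)

lemma cj_eq_0_iff: "cj x = 0 \<longleftrightarrow> x = 0"
proof
  assume "cj x = 0"
  then have "cj x = cj 0"
    by (simp add: cj_0)
  then show "x = 0"
    using automorphism unfolding is_nontrivial_automorphism_def by (metis bij_pointE)
qed (simp add: cj_0)

lemma cj_divide: "cj (x / y) = cj x / cj y"
proof (cases "y = 0")
  case False
  then have "cj (x / y) * cj y = cj x"
    by (simp add: cj_mult[symmetric])
  then show ?thesis
    using False by (simp add: cj_eq_0_iff field_simps)
qed (simp add: cj_0)

text \<open>Otherwise \<open>cj\<close> would fix \<open>K\<close> and \<omega>, hence all of the
  field, contrary to being nontrivial.\<close>

lemma omega_ne_cj: "\<omega> \<noteq> cj \<omega>"
proof
  assume eq: "\<omega> = cj \<omega>"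
  have "cj z = z" for z
    by (rule K_basis[of z]) (use eq in \<open>simp add: cj_add cj_mult cj_K\<close>)
  then show False
    using automorphism by (auto simp: is_nontrivial_automorphism_def)
qed

text \<open>Subtracting from \<omega> * \<omega> = n + t * \<omega> its image under
  \<open>cj\<close> leaves a product with the nonzero factor \<omega> - cj \<omega>. Hence the trace
  is \<open>t\<close>, and then the norm is \<open>- n\<close>.\<close>

lemma omega_trace_norm: "\<omega> + cj \<omega> \<in> OK" "\<omega> * cj \<omega> \<in> OK"
proof -
  obtain n t where nt: "n \<in> OK" "t \<in> OK" "\<omega> * \<omega> = n + t * \<omega>"
    using OL_basis[of "\<omega> * \<omega>"] omega_OL by auto
  have "cj \<omega> * cj \<omega> = n + t * cj \<omega>"
    using arg_cong[OF nt(3), of cj] nt(1,2) by (simp add: cj_mult cj_add cj_K OK_imp_K)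
  then have "(\<omega> - cj \<omega>) * (\<omega> + cj \<omega> - t) = 0"
    using nt(3) by Groebner_Basis.algebra
  then have t: "\<omega> + cj \<omega> = t"
    using omega_ne_cj by simp
  then have "cj \<omega> = t - \<omega>"
    by (simp add: algebra_simps)
  then have "\<omega> * cj \<omega> = - n"
    using nt(3) by (simp add: right_diff_distrib mult.commute)
  then show "\<omega> + cj \<omega> \<in> OK" "\<omega> * cj \<omega> \<in> OK"
    using t nt by auto
qed

text \<open>The trace of \<omega> lies in \<open>K\<close> and so is fixed; therefore
  \<open>cj\<close> interchanges \<omega> and its conjugate.\<close>

lemma cj_cj: "cj (cj z) = z"
proof -
  have "cj (\<omega> + cj \<omega>) = \<omega> + cj \<omega>"
    using omega_trace_norm by (intro cj_K OK_imp_K)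
  then have "cj (cj \<omega>) = \<omega>"
    by (simp add: cj_add)
  then show ?thesis
    by - (rule K_basis[of z], simp add: cj_add cj_mult cj_K)
qed

lemma cj_OL: "z \<in> OL \<Longrightarrow> cj z \<in> OL"
proof -
  have "cj \<omega> \<in> OL"
    using OL_diff[OF OK_imp_OL[OF omega_trace_norm(1)] omega_OL] by simp
  moreover assume "z \<in> OL"
  then obtain x y where "x \<in> OK" "y \<in> OK" "z = x + y * \<omega>"
    by (rule OL_basis)
  ultimately show "cj z \<in> OL"
    by (simp add: cj_add cj_mult cj_K OK_imp_K OK_imp_OL)
qed

text \<open>In coordinates, \<open>z - cj z\<close> is \<omega> - cj \<omega> times the coordinate
  of \<open>z\<close> at \<omega>.\<close>

lemma in_K_iff: "z \<in> K \<longleftrightarrow> cj z = z"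
proof
  assume z: "cj z = z"
  obtain x y where xy: "x \<in> K" "y \<in> K" "z = x + y * \<omega>"
    by (rule K_basis)
  have "y * (\<omega> - cj \<omega>) = z - cj z"
    using xy by (simp add: cj_add cj_mult cj_K algebra_simps)
  then have "y * (\<omega> - cj \<omega>) = 0"
    using z by simp
  then show "z \<in> K"
    using omega_ne_cj xy by auto
qed (rule cj_K)

lemma norm_K: "z * cj z \<in> K"
  by (simp add: in_K_iff cj_mult cj_cj mult.commute)

lemma norm_eq_0_iff: "z * cj z = 0 \<longleftrightarrow> z = 0"
  by (simp add: cj_eq_0_iff)

section \<open>Real embeddings, signs and totally positive units\<close>

lemma embedding:
  assumes "\<sigma> \<in> real_embeddings K"
  shows embedding_mult: "\<And>x y. x \<in> K \<Longrightarrow> y \<in> K \<Longrightarrow> \<sigma> (x * y) = \<sigma> x * \<sigma> y"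
    and embedding_add: "\<And>x y. x \<in> K \<Longrightarrow> y \<in> K \<Longrightarrow> \<sigma> (x + y) = \<sigma> x + \<sigma> y"
    and embedding_1: "\<sigma> 1 = 1"
  using assms by (auto simp: real_embeddings_def)

lemma embedding_minus:
  assumes "\<sigma> \<in> real_embeddings K" "x \<in> K"
  shows "\<sigma> (- x) = - \<sigma> x"
  using embedding_add[OF assms(1), of 0 0] embedding_add[OF assms(1), of x "- x"] assms(2) by simp

lemma embedding_nonzero:
  assumes "\<sigma> \<in> real_embeddings K" "x \<in> K" "x \<noteq> 0"
  shows "\<sigma> x \<noteq> 0"
  using embedding_mult[OF assms(1), of x "inverse x"] embedding_1[OF assms(1)] assms by auto

lemma embedding_inverse:
  assumes "\<sigma> \<in> real_embeddings K" "x \<in> K" "x \<noteq> 0"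
  shows "\<sigma> (inverse x) = inverse (\<sigma> x)"
  using embedding_mult[OF assms(1), of x "inverse x"] embedding_1[OF assms(1)]
    embedding_nonzero[OF assms] assms by (simp add: field_simps)

lemma totally_positive_1: "totally_positive K 1"
proof -
  have "\<sigma> 1 > 0" if "\<sigma> \<in> real_embeddings K" for \<sigma>
    using embedding_1[OF that] by simp
  then show ?thesis
    by (simp add: totally_positive_def)
qed

lemma totally_positive_mult:
  assumes "totally_positive K x" "totally_positive K y"
  shows "totally_positive K (x * y)"
proof -
  have "\<sigma> (x * y) > 0" if "\<sigma> \<in> real_embeddings K" for \<sigma>
    using embedding_mult[OF that, of x y] assms that by (simp add: totally_positive_def)
  then show ?thesis
    using assms by (simp add: totally_positive_def)
qed

lemma totally_positive_inverse:
  assumes "totally_positive K x"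
  shows "totally_positive K (inverse x)"
proof -
  have "\<sigma> (inverse x) > 0" if "\<sigma> \<in> real_embeddings K" for \<sigma>
    using embedding_inverse[OF that, of x] assms that by (simp add: totally_positive_def)
  then show ?thesis
    using assms by (simp add: totally_positive_def)
qed

lemma sign_vector_mult:
  assumes "x \<in> K" "y \<in> K"
  shows "(\<lambda>\<sigma>\<in>real_embeddings K. sign_vector K x \<sigma> * sign_vector K y \<sigma>) = sign_vector K (x * y)"
proof
  fix \<sigma>
  show "(\<lambda>\<sigma>\<in>real_embeddings K. sign_vector K x \<sigma> * sign_vector K y \<sigma>) \<sigma> = sign_vector K (x * y) \<sigma>"
    using embedding_mult[of \<sigma>, OF _ assms] by (simp add: sign_vector_def sgn_mult)
qed

lemma sign_vector_eq_iff:
  assumes "x \<in> K" "y \<in> K" "x \<noteq> 0" "y \<noteq> 0"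
  shows "sign_vector K x = sign_vector K y \<longleftrightarrow> totally_positive K (x / y)"
proof -
  have "sign_vector K x = sign_vector K y \<longleftrightarrow> (\<forall>\<sigma>\<in>real_embeddings K. sgn (\<sigma> x) = sgn (\<sigma> y))"
    by (auto simp: sign_vector_def restrict_def fun_eq_iff)
  also have "\<dots> \<longleftrightarrow> (\<forall>\<sigma>\<in>real_embeddings K. \<sigma> (x / y) > 0)"
  proof (intro ball_cong refl)
    fix \<sigma> assume s: "\<sigma> \<in> real_embeddings K"
    have "\<sigma> (x / y) = \<sigma> x / \<sigma> y"
      using assms s by (simp add: divide_inverse embedding_mult[OF s] embedding_inverse[OF s])
    then show "(sgn (\<sigma> x) = sgn (\<sigma> y)) = (\<sigma> (x / y) > 0)"
      using embedding_nonzero[OF s assms(1,3)] embedding_nonzero[OF s assms(2,4)]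
      by (auto simp: sgn_if zero_less_divide_iff)
  qed
  finally show ?thesis
    using assms by (auto simp: totally_positive_def)
qed

lemma pos_unitD:
  assumes "u \<in> pos_unit_set K"
  shows "u \<in> OK" "u \<in> K" "u \<noteq> 0" "totally_positive K u" "inverse u \<in> OK"
proof -
  obtain v where v: "u \<in> OK" "v \<in> OK" "u * v = 1" "totally_positive K u"
    using assms by (auto simp: pos_unit_set_def unit_set_def)
  then show "u \<in> OK" "u \<in> K" "u \<noteq> 0" "totally_positive K u"
    by (auto simp: OK_imp_K)
  have "inverse u = v"
    using v by (metis inverse_unique)
  then show "inverse u \<in> OK"
    using v by simp
qed

lemma pos_unitI:
  assumes "u \<in> OK" "inverse u \<in> OK" "totally_positive K u"
  shows "u \<in> pos_unit_set K"
proof -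
  have "u \<noteq> 0"
    using assms by (auto simp: totally_positive_def)
  then show ?thesis
    using assms by (auto simp: pos_unit_set_def unit_set_def intro!: bexI[of _ "inverse u"])
qed

lemma pos_unit_mult: "u \<in> pos_unit_set K \<Longrightarrow> v \<in> pos_unit_set K \<Longrightarrow> u * v \<in> pos_unit_set K"
  by (intro pos_unitI totally_positive_mult) (simp_all add: pos_unitD)

lemma pos_unit_inverse: "u \<in> pos_unit_set K \<Longrightarrow> inverse u \<in> pos_unit_set K"
  by (intro pos_unitI totally_positive_inverse) (simp_all add: pos_unitD)

lemma pos_unit_1: "1 \<in> pos_unit_set K"
  by (intro pos_unitI) (auto simp: totally_positive_1)

text \<open>Equal squares leave \<open>u = v\<close> or \<open>u = - v\<close>, and a real
  embedding, positive on both units, excludes the second. This makes the chosen square root of a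
  discriminant unambiguous.\<close>

lemma pos_unit_square_eq:
  assumes "u \<in> pos_unit_set K" "v \<in> pos_unit_set K" "u\<^sup>2 = v\<^sup>2"
  shows "u = v"
proof -
  obtain \<sigma> where s: "\<sigma> \<in> real_embeddings K"
    using real_place by auto
  have "\<sigma> u > 0" "\<sigma> v > 0"
    using assms s by (auto dest!: pos_unitD(4) simp: totally_positive_def)
  then have "u \<noteq> - v"
    using embedding_minus[OF s] pos_unitD(2)[OF assms(2)] by auto
  then show ?thesis
    using assms(3) by (auto simp: power2_eq_iff)
qed

lemma disc_sqrt_eq:
  assumes "u \<in> pos_unit_set K"
  shows "disc_sqrt K cj \<omega> (u\<^sup>2 * (\<omega> - cj \<omega>)\<^sup>2) = u * (\<omega> - cj \<omega>)"
  unfolding disc_sqrt_def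
proof (rule the_equality)
  show "\<exists>v\<in>pos_unit_set K. u\<^sup>2 * (\<omega> - cj \<omega>)\<^sup>2 = v\<^sup>2 * (\<omega> - cj \<omega>)\<^sup>2
      \<and> u * (\<omega> - cj \<omega>) = v * (\<omega> - cj \<omega>)"
    using assms by blast
  fix s assume "\<exists>v\<in>pos_unit_set K. u\<^sup>2 * (\<omega> - cj \<omega>)\<^sup>2 = v\<^sup>2 * (\<omega> - cj \<omega>)\<^sup>2 \<and> s = v * (\<omega> - cj \<omega>)"
  then obtain v where "v \<in> pos_unit_set K" "u\<^sup>2 = v\<^sup>2" "s = v * (\<omega> - cj \<omega>)"
    using omega_ne_cj by auto
  then show "s = u * (\<omega> - cj \<omega>)"
    using pos_unit_square_eq[OF assms] by simp
qed

end

section \<open>Ideals and oriented classes\<close>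

text \<open>The closure properties of a fractional ideal without the bound on denominators. With
  \<open>K\<close> for \<open>F\<close> these are modules over the integers of the base field, with
  \<open>UNIV\<close> over those of the extension.\<close>

definition integral_module :: "'a::field_char_0 set \<Rightarrow> 'a set \<Rightarrow> bool" where
  "integral_module F J \<longleftrightarrow> 0 \<in> J \<and> (\<forall>x\<in>J. \<forall>y\<in>J. x + y \<in> J) \<and>
     (\<forall>r\<in>integers_of F. \<forall>x\<in>J. r * x \<in> J)"

section \<open>Products of modules\<close>

lemma ideal_mult_zero: "0 \<in> ideal_mult I J"
  unfolding ideal_mult_def by (rule CollectI, rule exI[of _ 0]) simp

lemma ideal_mult_add_prod:
  assumes "z \<in> ideal_mult I J" "x \<in> I" "y \<in> J"
  shows "z + x * y \<in> ideal_mult I J"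
proof -
  obtain n :: nat and v w where z: "z = (\<Sum>i<n. v i * w i)" "\<forall>i<n. v i \<in> I \<and> w i \<in> J"
    using assms(1) unfolding ideal_mult_def by blast
  have "z + x * y = (\<Sum>i<Suc n. (v(n := x)) i * (w(n := y)) i)"
    unfolding z(1) by simp
  moreover have "\<forall>i<Suc n. (v(n := x)) i \<in> I \<and> (w(n := y)) i \<in> J"
    using z(2) assms(2,3) by (simp add: less_Suc_eq)
  ultimately show ?thesis
    unfolding ideal_mult_def by blast
qed

lemma ideal_mult_prod: "x \<in> I \<Longrightarrow> y \<in> J \<Longrightarrow> x * y \<in> ideal_mult I J"
  using ideal_mult_add_prod[OF ideal_mult_zero] by force

text \<open>Adding one product at a time replaces the handling of indexed sums in the facts that
  follow.\<close>

lemma ideal_mult_induct [consumes 1, case_names zero add_prod]: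
  assumes "z \<in> ideal_mult I J" and "P 0"
    and "\<And>z x y. z \<in> ideal_mult I J \<Longrightarrow> P z \<Longrightarrow> x \<in> I \<Longrightarrow> y \<in> J \<Longrightarrow> P (z + x * y)"
  shows "P z"
proof -
  obtain n :: nat and v w where z: "z = (\<Sum>i<n. v i * w i)" "\<And>i. i < n \<Longrightarrow> v i \<in> I \<and> w i \<in> J"
    using assms(1) unfolding ideal_mult_def by blast
  have "(\<Sum>i<m. v i * w i) \<in> ideal_mult I J \<and> P (\<Sum>i<m. v i * w i)" if "m \<le> n" for m
    using that by (induction m) (auto simp: z(2) assms ideal_mult_zero ideal_mult_add_prod)
  then show ?thesis
    using z(1) by simp
qed

lemma ideal_mult_add:
  assumes "y \<in> ideal_mult I J" "z \<in> ideal_mult I J"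
  shows "y + z \<in> ideal_mult I J"
  using assms(2)
  by (induction rule: ideal_mult_induct)
    (simp_all add: assms(1) ideal_mult_add_prod add.assoc[symmetric])

text \<open>The universal property of the product: inclusions are tested on products of single
  elements.\<close>

lemma ideal_mult_least:
  assumes "\<And>x y. x \<in> I \<Longrightarrow> y \<in> J \<Longrightarrow> x * y \<in> M" and "0 \<in> M"
    and "\<And>x y. x \<in> M \<Longrightarrow> y \<in> M \<Longrightarrow> x + y \<in> M"
  shows "ideal_mult I J \<subseteq> M"
proof
  fix z assume "z \<in> ideal_mult I J"
  then show "z \<in> M"
    by (induction rule: ideal_mult_induct) (auto intro: assms)
qed

lemma ideal_mult_commute: "ideal_mult I J = ideal_mult J I"
proof -
  have "ideal_mult I J \<subseteq> ideal_mult J I" for I J :: "'a set"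
    by (intro ideal_mult_least ideal_mult_add ideal_mult_zero)
      (metis mult.commute ideal_mult_prod)
  then show ?thesis
    by blast
qed

lemma ideal_mult_scale: "ideal_mult ((*) \<gamma> ` I) J = (*) \<gamma> ` ideal_mult I J"
proof
  have sum: "\<gamma> * x + \<gamma> * y \<in> (*) \<gamma> ` ideal_mult I J" if "x \<in> ideal_mult I J" "y \<in> ideal_mult I J" for x y
    using ideal_mult_add[OF that] by (auto simp: distrib_left[symmetric])
  show "ideal_mult ((*) \<gamma> ` I) J \<subseteq> (*) \<gamma> ` ideal_mult I J"
    by (rule ideal_mult_least)
      (auto simp: mult.assoc image_iff[of 0] intro: ideal_mult_prod ideal_mult_zero bexI[of _ 0] sum)
  have "\<gamma> * z \<in> ideal_mult ((*) \<gamma> ` I) J" if "z \<in> ideal_mult I J" for z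
    using that
  proof (induction rule: ideal_mult_induct)
    case (add_prod z x y)
    then have "\<gamma> * z + (\<gamma> * x) * y \<in> ideal_mult ((*) \<gamma> ` I) J"
      by (intro ideal_mult_add_prod) auto
    then show ?case
      by (simp add: algebra_simps)
  qed (simp add: ideal_mult_zero)
  then show "(*) \<gamma> ` ideal_mult I J \<subseteq> ideal_mult ((*) \<gamma> ` I) J"
    by blast
qed

lemma ideal_mult_scale_right: "ideal_mult I ((*) \<gamma> ` J) = (*) \<gamma> ` ideal_mult I J"
  by (metis ideal_mult_commute ideal_mult_scale)

lemma ideal_mult_assoc: "ideal_mult (ideal_mult I J) M = ideal_mult I (ideal_mult J M)"
proof -
  have sub: "ideal_mult (ideal_mult I J) M \<subseteq> ideal_mult I (ideal_mult J M)" for I J M :: "'a set"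
  proof (intro ideal_mult_least ideal_mult_add ideal_mult_zero)
    fix z y assume "z \<in> ideal_mult I J" and y: "y \<in> M"
    then show "z * y \<in> ideal_mult I (ideal_mult J M)"
    proof (induction rule: ideal_mult_induct)
      case (add_prod z v w)
      then have "z * y + v * (w * y) \<in> ideal_mult I (ideal_mult J M)"
        using y by (intro ideal_mult_add_prod[of "z * y"] ideal_mult_prod[of w]) auto
      then show ?case
        by (simp add: algebra_simps)
    qed (simp add: ideal_mult_zero)
  qed
  \<comment> \<open>The reverse inclusion is \<open>sub\<close> with \<open>I\<close> and
    \<open>M\<close> exchanged, rewritten by commutativity.\<close>
  show ?thesis
    using sub[of I J M] sub[of M J I] by (simp add: ideal_mult_commute subset_antisym)
qed

lemma ideal_mult_left_commute: "ideal_mult I (ideal_mult J M) = ideal_mult J (ideal_mult I M)"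
  by (metis ideal_mult_assoc ideal_mult_commute)

lemma integral_module_ideal_mult:
  assumes "integral_module F I"
  shows "integral_module F (ideal_mult I J)"
  unfolding integral_module_def
proof (intro conjI ballI ideal_mult_zero ideal_mult_add)
  fix r z assume r: "r \<in> integers_of F" and "z \<in> ideal_mult I J"
  from this(2) show "r * z \<in> ideal_mult I J"
  proof (induction rule: ideal_mult_induct)
    case (add_prod z x y)
    then have "r * z + (r * x) * y \<in> ideal_mult I J"
      using assms r by (intro ideal_mult_add_prod) (auto simp: integral_module_def)
    then show ?case
      by (simp add: algebra_simps)
  qed (simp add: ideal_mult_zero)
qed

lemma integral_module_scale:
  assumes "integral_module F I"
  shows "integral_module F ((*) \<gamma> ` I)"
  unfolding integral_module_def
proof (intro conjI ballI)
  show "0 \<in> (*) \<gamma> ` I"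
    using assms by (auto simp: integral_module_def intro!: image_eqI[of _ _ 0])
  show "x + y \<in> (*) \<gamma> ` I" if "x \<in> (*) \<gamma> ` I" "y \<in> (*) \<gamma> ` I" for x y
    using that assms by (auto simp: integral_module_def distrib_left[symmetric])
  show "r * x \<in> (*) \<gamma> ` I" if "r \<in> integers_of F" "x \<in> (*) \<gamma> ` I" for r x
    using that assms by (auto simp: integral_module_def mult.left_commute)
qed

lemma principal_ideal_eq: "principal_ideal F \<gamma> = (*) \<gamma> ` integers_of F"
  by (auto simp: principal_ideal_def mult.commute)

lemma ideal_mult_integers:
  assumes "integral_module F I" "1 \<in> integers_of F"
  shows "ideal_mult (integers_of F) I = I"
proof
  show "ideal_mult (integers_of F) I \<subseteq> I"
    using assms by (intro ideal_mult_least) (auto simp: integral_module_def)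
  show "I \<subseteq> ideal_mult (integers_of F) I"
    using ideal_mult_prod[OF assms(2), of _ I] by auto
qed

lemma ideal_mult_principal:
  assumes "integral_module F I" "1 \<in> integers_of F"
  shows "ideal_mult (principal_ideal F \<gamma>) I = (*) \<gamma> ` I"
  by (simp add: principal_ideal_eq ideal_mult_scale ideal_mult_integers assms)

lemma span2_scale: "span2 K (\<mu> * \<alpha>) (\<mu> * \<beta>) = (*) \<mu> ` span2 K \<alpha> \<beta>"
proof
  show "span2 K (\<mu> * \<alpha>) (\<mu> * \<beta>) \<subseteq> (*) \<mu> ` span2 K \<alpha> \<beta>"
  proof
    fix z assume "z \<in> span2 K (\<mu> * \<alpha>) (\<mu> * \<beta>)"
    then obtain x y where "x \<in> integers_of K" "y \<in> integers_of K" "z = \<mu> * (x * \<alpha> + y * \<beta>)"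
      unfolding span2_def by (auto simp: algebra_simps)
    then show "z \<in> (*) \<mu> ` span2 K \<alpha> \<beta>"
      unfolding span2_def by blast
  qed
  show "(*) \<mu> ` span2 K \<alpha> \<beta> \<subseteq> span2 K (\<mu> * \<alpha>) (\<mu> * \<beta>)"
  proof
    fix z assume "z \<in> (*) \<mu> ` span2 K \<alpha> \<beta>"
    then obtain x y where "x \<in> integers_of K" "y \<in> integers_of K" "z = x * (\<mu> * \<alpha>) + y * (\<mu> * \<beta>)"
      unfolding span2_def by (auto simp: algebra_simps)
    then show "z \<in> span2 K (\<mu> * \<alpha>) (\<mu> * \<beta>)"
      unfolding span2_def by blast
  qed
qed

section \<open>Bezout identities from narrow class number one\<close>

context quadratic_order
begin

text \<open>The class group has a single element, so the cosets of \<open>I\<close> and of the unit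
  ideal coincide, and every member of the latter is principal.\<close>

lemma principal_if_fractional_ideal:
  assumes "I \<in> fractional_ideals K"
  shows "\<exists>\<gamma>. I = principal_ideal K \<gamma>"
proof -
  define H where "H = {principal_ideal K \<gamma> | \<gamma>. totally_positive K \<gamma>}"
  have OK: "OK \<in> fractional_ideals K" "integral_module K OK"
    unfolding fractional_ideals_def integral_module_def
    using OK_1 by (auto simp: OK_imp_K intro!: bexI[of _ 1] exI[of _ 1] simp del: OK_1)
  have I: "integral_module K I"
    using assms unfolding fractional_ideals_def integral_module_def by auto
  have "card (carrier (narrow_class_group K)) = 1"
    using narrow_class_number by (simp add: narrow_class_number_def)
  moreover have "H #>\<^bsub>ideal_group K\<^esub> I \<in> carrier (narrow_class_group K)"
    "H #>\<^bsub>ideal_group K\<^esub> OK \<in> carrier (narrow_class_group K)"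
    using assms OK(1) by (auto simp: narrow_class_group_def carrier_FactGroup ideal_group_def H_def)
  ultimately have "H #>\<^bsub>ideal_group K\<^esub> I = H #>\<^bsub>ideal_group K\<^esub> OK"
    by (metis card_1_singletonE singletonD)
  moreover have "OK \<in> H"
    using totally_positive_1 unfolding H_def
    by (intro CollectI exI[of _ 1]) (simp add: principal_ideal_def)
  then have "ideal_mult OK I \<in> H #>\<^bsub>ideal_group K\<^esub> I"
    by (auto simp: r_coset_def ideal_group_def)
  ultimately have "I \<in> H #>\<^bsub>ideal_group K\<^esub> OK"
    by (simp add: ideal_mult_integers I)
  then obtain \<gamma> where "I = ideal_mult (principal_ideal K \<gamma>) OK"
    by (auto simp: r_coset_def ideal_group_def H_def)
  then show ?thesis
    using ideal_mult_principal[OF OK(2)] by (auto simp: principal_ideal_eq)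
qed

text \<open>The ideal generated by the coefficients has a single generator. This generator divides
  all three coefficients, so primitivity makes it a unit. The condition \<open>a \<noteq> 0\<close>
  ensures that the ideal is nonzero.\<close>

lemma primitive_form_bezout:
  assumes "primitive_form K (a, b, c)" "integral_form K (a, b, c)" "a \<noteq> 0"
  obtains x y z where "x \<in> OK" "y \<in> OK" "z \<in> OK" "x * a + y * b + z * c = 1"
proof -
  define I where "I = {x * a + y * b + z * c | x y z. x \<in> OK \<and> y \<in> OK \<and> z \<in> OK}"
  have abc: "a \<in> OK" "b \<in> OK" "c \<in> OK"
    using assms by auto
  have mem: "x * a + y * b + z * c \<in> I" if "x \<in> OK" "y \<in> OK" "z \<in> OK" for x y z
    using that by (auto simp: I_def)
  have I: "a \<in> I" "b \<in> I" "c \<in> I" "0 \<in> I"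
    using mem[of 1 0 0] mem[of 0 1 0] mem[of 0 0 1] mem[of 0 0 0] by simp_all
  have sub: "I \<subseteq> OK"
    using abc by (auto simp: I_def)
  have "I \<in> fractional_ideals K"
    unfolding fractional_ideals_def
  proof (intro CollectI conjI ballI)
    show "I \<subseteq> K" "0 \<in> I" "I \<noteq> {0}"
      using I sub OK_imp_K assms(3) by auto
    show "x + y \<in> I" if "x \<in> I" "y \<in> I" for x y
    proof -
      obtain x1 x2 x3 where x: "x1 \<in> OK" "x2 \<in> OK" "x3 \<in> OK" "x = x1 * a + x2 * b + x3 * c"
        using \<open>x \<in> I\<close> by (auto simp: I_def)
      obtain y1 y2 y3 where y: "y1 \<in> OK" "y2 \<in> OK" "y3 \<in> OK" "y = y1 * a + y2 * b + y3 * c"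
        using \<open>y \<in> I\<close> by (auto simp: I_def)
      show ?thesis
        using mem[of "x1 + y1" "x2 + y2" "x3 + y3"] x y by (simp add: algebra_simps)
    qed
    show "r * x \<in> I" if "r \<in> OK" "x \<in> I" for r x
    proof -
      obtain x1 x2 x3 where x: "x1 \<in> OK" "x2 \<in> OK" "x3 \<in> OK" "x = x1 * a + x2 * b + x3 * c"
        using \<open>x \<in> I\<close> by (auto simp: I_def)
      show ?thesis
        using mem[of "r * x1" "r * x2" "r * x3"] x that by (simp add: algebra_simps)
    qed
    show "\<exists>d\<in>OK. d \<noteq> 0 \<and> (\<forall>x\<in>I. d * x \<in> OK)"
      using sub by (intro bexI[of _ 1]) auto
  qed
  then obtain d where d: "I = principal_ideal K d"
    using principal_if_fractional_ideal by blast
  then have "d \<in> I"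
    unfolding principal_ideal_eq using OK_1 by (metis image_eqI mult.right_neutral)
  have "int_dvd K d a" "int_dvd K d b" "int_dvd K d c"
    using I d by (auto simp: int_dvd_def principal_ideal_eq)
  then have "d \<in> unit_set K"
    using assms(1) \<open>d \<in> I\<close> sub by auto
  then obtain e where "e \<in> OK" "d * e = 1"
    by (auto simp: unit_set_def)
  moreover obtain x y z where "x \<in> OK" "y \<in> OK" "z \<in> OK" "d = x * a + y * b + z * c"
    using \<open>d \<in> I\<close> by (auto simp: I_def)
  ultimately show thesis
    using that[of "e * x" "e * y" "e * z"] by (simp add: algebra_simps)
qed

section \<open>Calculation with oriented classes\<close>

text \<open>The orientation is given by an element \<open>a\<close> of the field and enters through
  its signs, so that multiplying orientations becomes multiplying field elements.\<close>

definition oriented_class :: "'a set \<Rightarrow> 'a \<Rightarrow> 'a oriented_ideal set" where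
  "oriented_class I a =
     principal_oriented_ideals K cj #>\<^bsub>oriented_ideal_group K\<^esub> (I, sign_vector K a)"

text \<open>Turns the coset into the orbit of one oriented module under multiplication by nonzero
  elements, with the norm acting on the orientation.\<close>

lemma oriented_class_eq:
  assumes "integral_module UNIV I" "a \<in> K"
  shows "oriented_class I a = {((*) \<gamma> ` I, sign_vector K (\<gamma> * cj \<gamma> * a)) | \<gamma>. \<gamma> \<noteq> 0}"
  unfolding oriented_class_def r_coset_def principal_oriented_ideals_def oriented_ideal_group_def
  by (auto simp: ideal_mult_principal[OF assms(1)] sign_vector_mult[OF norm_K assms(2)])

text \<open>Both sides are the same orbit, reparametrized by \<gamma> * \<mu> in one direction and
  by \<gamma> / \<mu> in the other.\<close>

lemma oriented_class_scale:
  assumes "integral_module UNIV I" "a \<in> K" "\<mu> \<noteq> 0"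
  shows "oriented_class ((*) \<mu> ` I) (\<mu> * cj \<mu> * a) = oriented_class I a"
proof -
  have 1: "oriented_class ((*) \<mu> ` I) (\<mu> * cj \<mu> * a)
      = {((*) (\<gamma> * \<mu>) ` I, sign_vector K (\<gamma> * \<mu> * cj (\<gamma> * \<mu>) * a)) | \<gamma>. \<gamma> \<noteq> 0}"
    unfolding oriented_class_eq[OF integral_module_scale[OF assms(1)] K_mult[OF norm_K assms(2)]]
    by (simp add: image_image cj_mult mult.assoc mult.left_commute)
  show ?thesis
    unfolding 1 oriented_class_eq[OF assms(1,2)]
  proof (intro equalityI subsetI; elim CollectE exE conjE)
    fix z \<gamma>
    assume *: "z = ((*) (\<gamma> * \<mu>) ` I, sign_vector K (\<gamma> * \<mu> * cj (\<gamma> * \<mu>) * a))" "\<gamma> \<noteq> 0"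
    then show "z \<in> {((*) \<gamma> ` I, sign_vector K (\<gamma> * cj \<gamma> * a)) | \<gamma>. \<gamma> \<noteq> 0}"
      using assms(3) by (intro CollectI exI[of _ "\<gamma> * \<mu>"]) simp
  next
    fix z \<gamma>
    assume *: "z = ((*) \<gamma> ` I, sign_vector K (\<gamma> * cj \<gamma> * a))" "\<gamma> \<noteq> 0"
    then show "z \<in> {((*) (\<gamma> * \<mu>) ` I, sign_vector K (\<gamma> * \<mu> * cj (\<gamma> * \<mu>) * a)) | \<gamma>. \<gamma> \<noteq> 0}"
      using assms(3) by (intro CollectI exI[of _ "\<gamma> / \<mu>"]) simp
  qed
qed

text \<open>Representatives with scalars \<gamma> and \<delta> multiply to the representative with
  scalar \<gamma> * \<delta>.\<close>

lemma oriented_class_mult: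
  assumes "integral_module UNIV I" "a \<in> K" "integral_module UNIV J" "b \<in> K"
  shows "oriented_class I a <#>\<^bsub>oriented_ideal_group K\<^esub> oriented_class J b
    = oriented_class (ideal_mult I J) (a * b)"
proof -
  have prod: "((*) \<gamma> ` I, sign_vector K (\<gamma> * cj \<gamma> * a)) \<otimes>\<^bsub>oriented_ideal_group K\<^esub>
      ((*) \<delta> ` J, sign_vector K (\<delta> * cj \<delta> * b))
    = ((*) (\<gamma> * \<delta>) ` ideal_mult I J, sign_vector K (\<gamma> * \<delta> * cj (\<gamma> * \<delta>) * (a * b)))" for \<gamma> \<delta>
  proof -
    have "ideal_mult ((*) \<gamma> ` I) ((*) \<delta> ` J) = (*) (\<gamma> * \<delta>) ` ideal_mult I J"
      by (simp add: ideal_mult_scale ideal_mult_scale_right image_image mult.assoc mult.left_commute)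
    moreover have eq: "(\<gamma> * cj \<gamma> * a) * (\<delta> * cj \<delta> * b) = \<gamma> * \<delta> * cj (\<gamma> * \<delta>) * (a * b)"
      by (simp add: cj_mult mult_ac)
    ultimately show ?thesis
      using sign_vector_mult[OF K_mult[OF norm_K assms(2)] K_mult[OF norm_K assms(4)], of \<gamma> \<delta>]
      unfolding eq by (simp add: oriented_ideal_group_def)
  qed
  have 1: "oriented_class (ideal_mult I J) (a * b) = {((*) \<gamma> ` ideal_mult I J,
      sign_vector K (\<gamma> * cj \<gamma> * (a * b))) | \<gamma>. \<gamma> \<noteq> 0}"
    using assms by (intro oriented_class_eq integral_module_ideal_mult) auto
  show ?thesis
  proof
    show "oriented_class I a <#>\<^bsub>oriented_ideal_group K\<^esub> oriented_class J b
        \<subseteq> oriented_class (ideal_mult I J) (a * b)"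
    proof
      fix z assume "z \<in> oriented_class I a <#>\<^bsub>oriented_ideal_group K\<^esub> oriented_class J b"
      then obtain \<gamma> \<delta> where "\<gamma> \<noteq> 0" "\<delta> \<noteq> 0"
        "z = ((*) \<gamma> ` I, sign_vector K (\<gamma> * cj \<gamma> * a)) \<otimes>\<^bsub>oriented_ideal_group K\<^esub>
          ((*) \<delta> ` J, sign_vector K (\<delta> * cj \<delta> * b))"
        unfolding set_mult_def oriented_class_eq[OF assms(1,2)] oriented_class_eq[OF assms(3,4)]
        by blast
      then show "z \<in> oriented_class (ideal_mult I J) (a * b)"
        unfolding 1 prod by (intro CollectI exI[of _ "\<gamma> * \<delta>"]) simp
    qed
    show "oriented_class (ideal_mult I J) (a * b)
        \<subseteq> oriented_class I a <#>\<^bsub>oriented_ideal_group K\<^esub> oriented_class J b"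
    proof
      fix z assume "z \<in> oriented_class (ideal_mult I J) (a * b)"
      then obtain \<gamma> where "\<gamma> \<noteq> 0" and
        "z = ((*) \<gamma> ` ideal_mult I J, sign_vector K (\<gamma> * cj \<gamma> * (a * b)))"
        unfolding 1 by blast
      \<comment> \<open>For the converse the whole scalar is put on the first factor, with scalar 1
        on the second.\<close>
      then have "z = ((*) \<gamma> ` I, sign_vector K (\<gamma> * cj \<gamma> * a)) \<otimes>\<^bsub>oriented_ideal_group K\<^esub>
          ((*) 1 ` J, sign_vector K (1 * cj 1 * b))"
        unfolding prod by simp
      moreover have "((*) 1 ` J, sign_vector K (1 * cj 1 * b)) \<in> oriented_class J b"
        unfolding oriented_class_eq[OF assms(3,4)] by (intro CollectI exI[of _ 1]) simp
      moreover have "((*) \<gamma> ` I, sign_vector K (\<gamma> * cj \<gamma> * a)) \<in> oriented_class I a"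
        unfolding oriented_class_eq[OF assms(1,2)] using \<open>\<gamma> \<noteq> 0\<close> by blast
      ultimately show "z \<in> oriented_class I a <#>\<^bsub>oriented_ideal_group K\<^esub> oriented_class J b"
        unfolding set_mult_def by blast
    qed
  qed
qed

lemma integral_module_OL: "integral_module UNIV OL"
  by (simp add: integral_module_def)

lemma oriented_class_one: "oriented_class OL 1 = principal_oriented_ideals K cj"
  by (simp add: oriented_class_eq integral_module_OL principal_oriented_ideals_def
      principal_ideal_eq)

lemma oriented_class_eqD:
  assumes "integral_module UNIV I" "a \<in> K" "integral_module UNIV J" "b \<in> K"
    and "oriented_class I a = oriented_class J b"
  obtains \<mu> where "\<mu> \<noteq> 0" "J = (*) \<mu> ` I" "sign_vector K b = sign_vector K (\<mu> * cj \<mu> * a)"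
proof -
  have "(J, sign_vector K b) \<in> oriented_class J b"
    unfolding oriented_class_eq[OF assms(3,4)] by (intro CollectI exI[of _ 1]) (simp add: cj_1)
  then have "(J, sign_vector K b) \<in> oriented_class I a"
    using assms(5) by simp
  then show thesis
    using that unfolding oriented_class_eq[OF assms(1,2)] by blast
qed

lemma oriented_class_sign:
  "sign_vector K a = sign_vector K b \<Longrightarrow> oriented_class I a = oriented_class I b"
  by (simp add: oriented_class_def)

section \<open>Forms and their modules\<close>

text \<open>The root of z * z + b * z + a * c that belongs to the chosen square root of the
  discriminant, written with the unit \<open>u\<close> as a parameter.\<close>

definition form_root :: "'a \<Rightarrow> 'a \<Rightarrow> 'a" where
  "form_root u b = (- b + u * (\<omega> - cj \<omega>)) / 2"

text \<open>Carrying \<open>u\<close> explicitly fixes the square root of the discriminant, so that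
  most arguments do not touch the description operator in \<open>disc_sqrt\<close>.\<close>

definition form_with_unit :: "'a \<Rightarrow> 'a form \<Rightarrow> bool" where
  "form_with_unit u Q \<longleftrightarrow> integral_form K Q \<and> primitive_form K Q \<and> u \<in> pos_unit_set K \<and>
     form_disc Q = u\<^sup>2 * (\<omega> - cj \<omega>)\<^sup>2"

lemma forms_with_disc_iff: "Q \<in> forms_with_disc K cj \<omega> \<longleftrightarrow> (\<exists>u. form_with_unit u Q)"
  by (auto simp: forms_with_disc_def form_with_unit_def disc_set_def)

lemma form_root_double: "2 * form_root u b = - b + u * (\<omega> - cj \<omega>)"
  by (simp add: form_root_def field_simps)

lemma form_root_trace:
  assumes "u \<in> K" "b \<in> K"
  shows "cj (form_root u b) = (- b - u * (\<omega> - cj \<omega>)) / 2"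
    and "form_root u b + cj (form_root u b) = - b"
    and "form_root u b - cj (form_root u b) = u * (\<omega> - cj \<omega>)"
  using assms by (simp_all add: form_root_def cj_divide cj_add cj_minus cj_mult cj_diff cj_cj cj_K
      field_simps)

lemma form_unitD:
  assumes "form_with_unit u (a, b, c)"
  shows "a \<in> OK" "b \<in> OK" "c \<in> OK" "a \<in> K" "b \<in> K" "c \<in> K" "u \<in> pos_unit_set K" "u \<in> K"
    and form_unit_disc: "b\<^sup>2 - 4 * a * c = u\<^sup>2 * (\<omega> - cj \<omega>)\<^sup>2"
    and form_unit_primitive: "primitive_form K (a, b, c)"
  using assms by (auto simp: form_with_unit_def OK_imp_K pos_unitD)

lemma form_root_norm:
  assumes "form_with_unit u (a, b, c)"
  shows "form_root u b * cj (form_root u b) = a * c"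
proof -
  have "4 * (form_root u b * cj (form_root u b)) = b\<^sup>2 - u\<^sup>2 * (\<omega> - cj \<omega>)\<^sup>2"
    unfolding form_root_trace(1)[OF form_unitD(8,5)[OF assms]]
    by (simp add: form_root_def field_simps power2_eq_square)
  also have "\<dots> = 4 * (a * c)"
    using form_unit_disc[OF assms] by (simp add: algebra_simps)
  finally show ?thesis
    by simp
qed

lemma form_root_square:
  assumes "form_with_unit u (a, b, c)"
  shows "(form_root u b)\<^sup>2 = - b * form_root u b - a * c"
proof -
  have "(form_root u b)\<^sup>2
      = (form_root u b + cj (form_root u b)) * form_root u b - form_root u b * cj (form_root u b)"
    by (simp add: algebra_simps power2_eq_square)
  then show ?thesis
    using form_root_trace(2) form_root_norm[OF assms] form_unitD[OF assms] by simp
qed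

lemma form_root_OL:
  assumes "form_with_unit u (a, b, c)"
  shows "form_root u b \<in> OL"
proof -
  have "(form_root u b)\<^sup>2 + b * form_root u b + a * c = 0"
    using form_root_square[OF assms] by simp
  then show ?thesis
    using form_unitD[OF assms] algebraic_int_quadratic[of b "a * c" "form_root u b"] OK_mult[of a c]
    by (simp add: OL_iff OK_iff)
qed

text \<open>Conjugation negates \<omega> - cj \<omega>, so a multiple of it by an element of
  \<open>K\<close> is fixed only if it vanishes.\<close>

lemma disc_in_K_imp: "u * (\<omega> - cj \<omega>) \<in> K \<Longrightarrow> u \<in> K \<Longrightarrow> u = 0"
  using omega_ne_cj by (auto simp: in_K_iff cj_mult cj_diff cj_cj algebra_simps)

text \<open>With \<open>a = 0\<close> the discriminant would be the square of \<open>b\<close>,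
  putting its square root \<open>u * (\<omega> - cj \<omega>)\<close> into \<open>K\<close>.\<close>

lemma form_lead_nonzero:
  assumes "form_with_unit u (a, b, c)"
  shows "a \<noteq> 0"
proof
  assume "a = 0"
  then have "b\<^sup>2 = (u * (\<omega> - cj \<omega>))\<^sup>2"
    using form_unit_disc[OF assms] by (simp add: power_mult_distrib)
  then have "u * (\<omega> - cj \<omega>) = b \<or> u * (\<omega> - cj \<omega>) = - b"
    by (auto simp: power2_eq_iff)
  then have "u = 0"
    using disc_in_K_imp form_unitD[OF assms] by auto
  then show False
    using pos_unitD form_unitD[OF assms] by blast
qed

lemma form_factor:
  assumes "form_with_unit u (a, b, c)"
  shows "a * form_eval (a, b, c) x y = (a * x - form_root u b * y) * (a * x - cj (form_root u b) * y)"
proof -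
  have "(a * x - form_root u b * y) * (a * x - cj (form_root u b) * y)
      = a\<^sup>2 * x\<^sup>2 - (form_root u b + cj (form_root u b)) * a * x * y
        + (form_root u b * cj (form_root u b)) * y\<^sup>2"
    by (simp add: algebra_simps power2_eq_square)
  also have "\<dots> = a * form_eval (a, b, c) x y"
    using form_root_trace(2) form_root_norm[OF assms] form_unitD[OF assms]
    by (simp add: algebra_simps power2_eq_square)
  finally show ?thesis ..
qed

section \<open>The module of a form\<close>

definition form_module :: "'a \<Rightarrow> 'a form \<Rightarrow> 'a set" where
  "form_module u Q = span2 K (fst Q) (form_root u (fst (snd Q)))"

lemma form_ideal_eq:
  assumes "form_with_unit u (a, b, c)"
  shows "form_ideal K cj \<omega> (a, b, c) = (form_module u (a, b, c), sign_vector K a)"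
  using form_unitD[OF assms] by (simp add: form_module_def form_root_def disc_sqrt_eq)

lemma span2_memI: "x \<in> OK \<Longrightarrow> y \<in> OK \<Longrightarrow> x * \<alpha> + y * \<beta> \<in> span2 K \<alpha> \<beta>"
  unfolding span2_def by blast

lemma span2E:
  assumes "z \<in> span2 K \<alpha> \<beta>"
  obtains x y where "x \<in> OK" "y \<in> OK" "z = x * \<alpha> + y * \<beta>"
  using assms unfolding span2_def by blast

lemma span2_gens: "\<alpha> \<in> span2 K \<alpha> \<beta>" "\<beta> \<in> span2 K \<alpha> \<beta>"
  using span2_memI[of 1 0 \<alpha> \<beta>] span2_memI[of 0 1 \<alpha> \<beta>] by simp_all

lemma integral_module_span2: "integral_module K (span2 K \<alpha> \<beta>)"
  unfolding integral_module_def
proof (intro conjI ballI)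
  show "0 \<in> span2 K \<alpha> \<beta>"
    using span2_memI[of 0 0] by simp
  fix v w assume "v \<in> span2 K \<alpha> \<beta>" "w \<in> span2 K \<alpha> \<beta>"
  then obtain x y x' y' where "x \<in> OK" "y \<in> OK" "v = x * \<alpha> + y * \<beta>"
    "x' \<in> OK" "y' \<in> OK" "w = x' * \<alpha> + y' * \<beta>"
    unfolding span2_def by blast
  then show "v + w \<in> span2 K \<alpha> \<beta>"
    using span2_memI[of "x + x'" "y + y'" \<alpha> \<beta>] by (simp add: algebra_simps)
next
  fix r v assume "r \<in> OK" "v \<in> span2 K \<alpha> \<beta>"
  then obtain x y where "x \<in> OK" "y \<in> OK" "v = x * \<alpha> + y * \<beta>"
    unfolding span2_def by blast
  then show "r * v \<in> span2 K \<alpha> \<beta>"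
    using span2_memI[of "r * x" "r * y" \<alpha> \<beta>] \<open>r \<in> OK\<close> by (simp add: algebra_simps)
qed

lemma span2_add: "v \<in> span2 K \<alpha> \<beta> \<Longrightarrow> w \<in> span2 K \<alpha> \<beta> \<Longrightarrow> v + w \<in> span2 K \<alpha> \<beta>"
  and span2_mult: "r \<in> OK \<Longrightarrow> v \<in> span2 K \<alpha> \<beta> \<Longrightarrow> r * v \<in> span2 K \<alpha> \<beta>"
  using integral_module_span2[of \<alpha> \<beta>] by (auto simp: integral_module_def)

text \<open>The span is defined over the smaller ring only. It is stable under u * \<omega>, which
  differs from the root by an integer \<open>m\<close> of \<open>K\<close>, and hence under \<omega>
  because \<open>u\<close> is a unit.\<close>

lemma integral_module_form_module:
  assumes "form_with_unit u (a, b, c)"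
  shows "integral_module UNIV (form_module u (a, b, c))"
proof -
  let ?\<theta> = "form_root u b"
  note D = form_unitD[OF assms]
  define I where "I = span2 K a ?\<theta>"
  have I_add: "v + w \<in> I" if "v \<in> I" "w \<in> I" for v w
    using that by (simp add: I_def span2_add)
  have I_mult: "r * v \<in> I" if "r \<in> OK" "v \<in> I" for v r
    using that by (simp add: I_def span2_mult)
  \<comment> \<open>As a difference of integral elements \<open>m\<close> is integral; its closed
    form as half of \<open>u * (\<omega> + cj \<omega>) + b\<close> shows that it lies in
    \<open>K\<close>. Thus the division by 2 does no harm.\<close>
  define m where "m = u * \<omega> - ?\<theta>"
  have m: "m \<in> OK"
  proof (rule OK_if_OL)
    show "m \<in> OL"
      using form_root_OL[OF assms] omega_OL D by (simp add: m_def OK_imp_OL pos_unitD)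
    have m_eq: "m = (u * (\<omega> + cj \<omega>) + b) / 2"
      by (simp add: m_def form_root_def field_simps)
    show "m \<in> K"
      unfolding m_eq using D omega_trace_norm by (simp add: OK_imp_K)
  qed
  have gens: "u * \<omega> * a \<in> I" "u * \<omega> * ?\<theta> \<in> I"
  proof -
    have "u * \<omega> * a = m * a + a * ?\<theta>"
      by (simp add: m_def algebra_simps)
    then show "u * \<omega> * a \<in> I"
      using m D span2_memI[of m a a ?\<theta>] by (simp add: I_def)
    have "u * \<omega> * ?\<theta> = m * ?\<theta> + ?\<theta>\<^sup>2"
      by (simp add: m_def algebra_simps power2_eq_square)
    also have "\<dots> = (- c) * a + (m - b) * ?\<theta>"
      by (simp add: form_root_square[OF assms] algebra_simps)
    finally show "u * \<omega> * ?\<theta> \<in> I"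
      using m D span2_memI[of "- c" "m - b" a ?\<theta>] by (simp add: I_def)
  qed
  have omega: "\<omega> * v \<in> I" if v: "v \<in> I" for v
  proof -
    obtain x y where xy: "x \<in> OK" "y \<in> OK" "v = x * a + y * ?\<theta>"
      using v unfolding I_def span2_def by blast
    have "\<omega> * v = (inverse u * x) * (u * \<omega> * a) + (inverse u * y) * (u * \<omega> * ?\<theta>)"
      using pos_unitD(3)[OF D(7)] by (simp add: xy algebra_simps)
    also have "\<dots> \<in> I"
      using gens xy pos_unitD(5)[OF D(7)] by (intro I_add I_mult[of "inverse u * x"] I_mult[of "inverse u * y"]) auto
    finally show ?thesis .
  qed
  show ?thesis
    unfolding integral_module_def form_module_def fst_conv snd_conv I_def[symmetric]
  proof (intro conjI ballI)
    show "0 \<in> I" "\<And>x y. x \<in> I \<Longrightarrow> y \<in> I \<Longrightarrow> x + y \<in> I"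
      using integral_module_span2[of a ?\<theta>] by (auto simp: integral_module_def I_def)
    fix r v assume "r \<in> OL" "v \<in> I"
    moreover from this(1) obtain x y where "x \<in> OK" "y \<in> OK" "r = x + y * \<omega>"
      by (rule OL_basis)
    ultimately show "r * v \<in> I"
      using I_add[of "x * v" "y * (\<omega> * v)"] I_mult omega by (simp add: distrib_right mult.assoc)
  qed
qed

section \<open>Equivalence of forms and equality of oriented classes\<close>

lemma span2_unimodular_subset:
  assumes "p \<in> OK" "q \<in> OK" "r \<in> OK" "s \<in> OK"
  shows "span2 K (p * \<alpha> + r * \<beta>) (q * \<alpha> + s * \<beta>) \<subseteq> span2 K \<alpha> \<beta>"
proof
  fix z assume "z \<in> span2 K (p * \<alpha> + r * \<beta>) (q * \<alpha> + s * \<beta>)"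
  then obtain x y where "x \<in> OK" "y \<in> OK" "z = x * (p * \<alpha> + r * \<beta>) + y * (q * \<alpha> + s * \<beta>)"
    unfolding span2_def by blast
  then show "z \<in> span2 K \<alpha> \<beta>"
    using assms by (auto intro!: span2_add span2_mult span2_memI)
qed

lemma span2_unimodular:
  assumes "p \<in> OK" "q \<in> OK" "r \<in> OK" "s \<in> OK"
    and d: "p * s - q * r \<noteq> 0" "inverse (p * s - q * r) \<in> OK"
  shows "span2 K (p * \<alpha> + r * \<beta>) (q * \<alpha> + s * \<beta>) = span2 K \<alpha> \<beta>"
proof
  \<comment> \<open>The inverse of the determinant: multiplied by the adjugate matrix it recovers
    \<alpha> and \<beta> from the new generators.\<close>
  define e where "e = inverse (p * s - q * r)"
  have e: "e * (p * s - q * r) = 1"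
    using d by (simp add: e_def)
  let ?\<gamma> = "p * \<alpha> + r * \<beta>" and ?\<delta> = "q * \<alpha> + s * \<beta>"
  have "(e * s) * ?\<gamma> + (- (e * r)) * ?\<delta> = e * (p * s - q * r) * \<alpha>"
    "(- (e * q)) * ?\<gamma> + (e * p) * ?\<delta> = e * (p * s - q * r) * \<beta>"
    by (simp_all add: algebra_simps)
  then have "(e * s) * ?\<gamma> + (- (e * r)) * ?\<delta> = \<alpha>" "(- (e * q)) * ?\<gamma> + (e * p) * ?\<delta> = \<beta>"
    using e by simp_all
  moreover have "span2 K ((e * s) * ?\<gamma> + (- (e * r)) * ?\<delta>) ((- (e * q)) * ?\<gamma> + (e * p) * ?\<delta>)
      \<subseteq> span2 K ?\<gamma> ?\<delta>"
    using assms by (intro span2_unimodular_subset) (auto simp: e_def)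
  ultimately show "span2 K \<alpha> \<beta> \<subseteq> span2 K ?\<gamma> ?\<delta>"
    by simp
qed (use span2_unimodular_subset assms in blast)

text \<open>The values at (1, 0), (0, 1) and (1, 1) determine the coefficients.\<close>

lemma form_equiv_coeffs:
  assumes "\<forall>x\<in>K. \<forall>y\<in>K.
      form_eval (a', b', c') x y = v * form_eval (a, b, c) (p * x + q * y) (r * x + s * y)"
  shows "a' = v * (a * p\<^sup>2 + b * p * r + c * r\<^sup>2)"
    and "b' = v * (2 * a * p * q + b * (p * s + q * r) + 2 * c * r * s)"
    and "c' = v * (a * q\<^sup>2 + b * q * s + c * s\<^sup>2)"
proof -
  show a: "a' = v * (a * p\<^sup>2 + b * p * r + c * r\<^sup>2)"
    using assms[rule_format, of 1 0] by simp
  show c: "c' = v * (a * q\<^sup>2 + b * q * s + c * s\<^sup>2)"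
    using assms[rule_format, of 0 1] by simp
  have "a' + b' + c' = v * (a * (p + q)\<^sup>2 + b * (p + q) * (r + s) + c * (r + s)\<^sup>2)"
    using assms[rule_format, of 1 1] by simp
  then have "b' = v * (a * (p + q)\<^sup>2 + b * (p + q) * (r + s) + c * (r + s)\<^sup>2) - a' - c'"
    by (simp add: algebra_simps)
  then show "b' = v * (2 * a * p * q + b * (p * s + q * r) + 2 * c * r * s)"
    unfolding a c by (simp add: algebra_simps power2_eq_square)
qed

text \<open>The substitution yields a new basis \<gamma>, \<delta> of the first module, and a common
  scalar \<mu> carries it to the standard generators of the second. The orientations agree because
  the multiplier \<open>v\<close> is totally positive.\<close>

lemma form_equiv_imp_class_eq:
  assumes Q: "form_with_unit u (a, b, c)" and Q': "form_with_unit u' (a', b', c')"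
    and "form_equiv K (a, b, c) (a', b', c')"
  shows "oriented_class (form_module u' (a', b', c')) a' = oriented_class (form_module u (a, b, c)) a"
proof -
  note D = form_unitD[OF Q] and D' = form_unitD[OF Q']
  obtain p q r s v where pqrs: "p \<in> OK" "q \<in> OK" "r \<in> OK" "s \<in> OK"
    and v: "v \<in> pos_unit_set K" and det: "p * s - q * r \<in> pos_unit_set K"
    and ev: "\<forall>x\<in>K. \<forall>y\<in>K.
      form_eval (a', b', c') x y = v * form_eval (a, b, c) (p * x + q * y) (r * x + s * y)"
    using assms(3) unfolding form_equiv_def by blast
  note co = form_equiv_coeffs[OF ev]
  define \<Delta> where "\<Delta> = \<omega> - cj \<omega>"
  have \<Delta>: "\<Delta> \<noteq> 0"
    using omega_ne_cj by (simp add: \<Delta>_def)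
  have "u'\<^sup>2 * \<Delta>\<^sup>2 = b'\<^sup>2 - 4 * a' * c'"
    using form_unit_disc[OF Q'] by (simp add: \<Delta>_def)
  also have "\<dots> = (v * (p * s - q * r))\<^sup>2 * (b\<^sup>2 - 4 * a * c)"
    unfolding co by (simp add: algebra_simps power2_eq_square)
  also have "\<dots> = (v * (p * s - q * r) * u)\<^sup>2 * \<Delta>\<^sup>2"
    unfolding form_unit_disc[OF Q] by (simp add: \<Delta>_def power_mult_distrib)
  finally have "u'\<^sup>2 = (v * (p * s - q * r) * u)\<^sup>2"
    using \<Delta> by simp
  \<comment> \<open>The substitution multiplies the discriminant by the square of
    \<open>v * (p * s - q * r)\<close>; since all units involved are totally positive, the square
    roots correspond with the positive sign.\<close>
  then have u': "u' = v * (p * s - q * r) * u"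
    by (rule pos_unit_square_eq[OF D'(7) pos_unit_mult[OF pos_unit_mult[OF v det] D(7)]])
  define \<theta> where "\<theta> = form_root u b"
  define \<theta>' where "\<theta>' = form_root u' b'"
  \<comment> \<open>The linear factor of the first form at the point (p, r). The value there is
    \<open>a'\<close> up to \<open>v\<close>, so the norm of \<gamma> is \<open>a * a'\<close> up to
    \<open>v\<close>.\<close>
  define \<gamma> where "\<gamma> = p * a + (- r) * \<theta>"
  define \<delta> where "\<delta> = (- q) * a + s * \<theta>"
  have cj\<theta>: "cj \<theta> = - b - \<theta>" and \<theta>2: "\<theta>\<^sup>2 = - b * \<theta> - a * c"
    using form_root_trace(2)[OF D(8,5)] form_root_square[OF Q]
    by (simp_all add: \<theta>_def eq_diff_eq add.commute)
  have cj\<gamma>: "cj \<gamma> = p * a + r * (b + \<theta>)"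
    using D pqrs by (simp add: \<gamma>_def cj_add cj_mult cj_K OK_imp_K cj_minus cj_diff cj\<theta> algebra_simps)
  have n: "a * a' = v * (\<gamma> * cj \<gamma>)"
  proof -
    have "\<gamma> * cj \<gamma> = a\<^sup>2 * p\<^sup>2 + a * b * p * r - r\<^sup>2 * (b * \<theta> + \<theta>\<^sup>2)"
      unfolding cj\<gamma> by (simp add: \<gamma>_def algebra_simps power2_eq_square)
    also have "\<dots> = a * (a * p\<^sup>2 + b * p * r + c * r\<^sup>2)"
      unfolding \<theta>2 by (simp add: algebra_simps power2_eq_square)
    finally show ?thesis
      unfolding co(1) by simp
  qed
  have t: "a * \<theta>' = v * (\<delta> * cj \<gamma>)"
  proof -
    have u\<Delta>: "u * \<Delta> = 2 * \<theta> + b"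
      unfolding \<theta>_def form_root_double by (simp add: \<Delta>_def)
    have "2 * \<theta>' = - b' + v * (p * s - q * r) * (u * \<Delta>)"
      unfolding \<theta>'_def form_root_double by (simp add: \<Delta>_def u' mult.assoc)
    also have "\<dots> = 2 * (v * (- a * p * q - b * q * r - c * r * s + (p * s - q * r) * \<theta>))"
      unfolding u\<Delta> co by (simp add: algebra_simps)
    finally have \<theta>': "\<theta>' = v * (- a * p * q - b * q * r - c * r * s + (p * s - q * r) * \<theta>)"
      by simp
    have "\<delta> * cj \<gamma> = - (a\<^sup>2 * p * q) - a * q * r * b + a * (p * s - q * r) * \<theta>
        + s * r * (b * \<theta> + \<theta>\<^sup>2)"
      unfolding cj\<gamma> by (simp add: \<delta>_def algebra_simps power2_eq_square)
    also have "\<dots> = a * (- a * p * q - b * q * r - c * r * s + (p * s - q * r) * \<theta>)"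
      unfolding \<theta>2 by (simp add: algebra_simps power2_eq_square)
    finally show ?thesis
      unfolding \<theta>' by simp
  qed
  have a0: "a \<noteq> 0" "a' \<noteq> 0"
    using form_lead_nonzero Q Q' by auto
  then have \<gamma>0: "\<gamma> \<noteq> 0"
    using n by auto
  \<comment> \<open>Chosen to match the first generators; \<open>t\<close> and \<open>n\<close> show
    that it matches the second ones too.\<close>
  define \<mu> where "\<mu> = a' / \<gamma>"
  have \<mu>0: "\<mu> \<noteq> 0"
    using a0 \<gamma>0 by (simp add: \<mu>_def)
  have 1: "a' = \<mu> * \<gamma>"
    using \<gamma>0 by (simp add: \<mu>_def)
  have "a * (\<theta>' * \<gamma>) = a * (a' * \<delta>)"
  proof -
    have "a * (\<theta>' * \<gamma>) = (a * \<theta>') * \<gamma>"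
      by simp
    also have "\<dots> = v * (\<gamma> * cj \<gamma>) * \<delta>"
      unfolding t by simp
    finally show ?thesis
      unfolding n[symmetric] by simp
  qed
  then have 2: "\<theta>' = \<mu> * \<delta>"
    using a0 \<gamma>0 by (simp add: \<mu>_def field_simps)
  have "span2 K a' \<theta>' = (*) \<mu> ` span2 K \<gamma> \<delta>"
    unfolding 1 2 by (rule span2_scale)
  also have "span2 K \<gamma> \<delta> = span2 K a \<theta>"
    unfolding \<gamma>_def \<delta>_def using pqrs pos_unitD[OF det]
    by (intro span2_unimodular) (auto simp: algebra_simps)
  finally have I: "form_module u' (a', b', c') = (*) \<mu> ` form_module u (a, b, c)"
    by (simp add: form_module_def \<theta>_def \<theta>'_def)
  have "\<mu> * cj \<mu> * a = a' * v"
  proof -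
    have "\<mu> * cj \<mu> * a = a' * (a * a') / (\<gamma> * cj \<gamma>)"
      using D' by (simp add: \<mu>_def cj_divide cj_K)
    also have "\<dots> = a' * v"
      unfolding n using \<gamma>0 norm_eq_0_iff[of \<gamma>] by simp
    finally show ?thesis .
  qed
  then have "sign_vector K (\<mu> * cj \<mu> * a) = sign_vector K a'"
    using D'(4) pos_unitD[OF v] a0 by (simp add: sign_vector_eq_iff)
  then have "oriented_class ((*) \<mu> ` form_module u (a, b, c)) a'
      = oriented_class ((*) \<mu> ` form_module u (a, b, c)) (\<mu> * cj \<mu> * a)"
    by (intro oriented_class_sign) simp
  then show ?thesis
    unfolding I using oriented_class_scale[OF integral_module_form_module[OF Q] D(4) \<mu>0] by simp
qed

text \<open>The two modules agree up to a scalar, so their bases are related by integral matrices in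
  both directions. The determinant is shown to be a totally positive unit, and comparing linear
  factors gives the substitution.\<close>

lemma class_eq_imp_form_equiv:
  assumes Q: "form_with_unit u (a, b, c)" and Q': "form_with_unit u' (a', b', c')"
    and "oriented_class (form_module u (a, b, c)) a = oriented_class (form_module u' (a', b', c')) a'"
  shows "form_equiv K (a, b, c) (a', b', c')"
proof -
  note D = form_unitD[OF Q] and D' = form_unitD[OF Q']
  define \<theta> where "\<theta> = form_root u b"
  define \<theta>' where "\<theta>' = form_root u' b'"
  obtain \<mu> where \<mu>0: "\<mu> \<noteq> 0" and I: "form_module u' (a', b', c') = (*) \<mu> ` form_module u (a, b, c)"
    and sign: "sign_vector K a' = sign_vector K (\<mu> * cj \<mu> * a)"
    using oriented_class_eqD[OF integral_module_form_module[OF Q] D(4)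
        integral_module_form_module[OF Q'] D'(4) assms(3)] by blast
  have I: "span2 K a' \<theta>' = span2 K (\<mu> * a) (\<mu> * \<theta>)"
    unfolding span2_scale using I by (simp add: form_module_def \<theta>_def \<theta>'_def)
  obtain p r where pr: "p \<in> OK" "r \<in> OK" "a' = p * (\<mu> * a) + r * (\<mu> * \<theta>)"
    by (rule span2E[OF span2_gens(1)[of a' \<theta>', unfolded I]])
  obtain q s where qs: "q \<in> OK" "s \<in> OK" "\<theta>' = q * (\<mu> * a) + s * (\<mu> * \<theta>)"
    by (rule span2E[OF span2_gens(2)[of \<theta>' a', unfolded I]])
  obtain p' r' where pr': "p' \<in> OK" "r' \<in> OK" "\<mu> * a = p' * a' + r' * \<theta>'"
    by (rule span2E[OF span2_gens(1)[of "\<mu> * a" "\<mu> * \<theta>", folded I]])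
  obtain q' s' where qs': "q' \<in> OK" "s' \<in> OK" "\<mu> * \<theta> = q' * a' + s' * \<theta>'"
    by (rule span2E[OF span2_gens(2)[of "\<mu> * \<theta>" "\<mu> * a", folded I]])
  \<comment> \<open>An alternating expression which a change of generators over the integers of
    \<open>K\<close> multiplies by its determinant; it turns relations between bases into relations
    between determinants.\<close>
  define W where "W x y = y * cj x - x * cj y" for x y
  have W_lin: "W (p * x + r * y) (q * x + s * y) = (p * s - q * r) * W x y"
    if "p \<in> OK" "q \<in> OK" "r \<in> OK" "s \<in> OK" for p q r s x y
    using that by (simp add: W_def cj_add cj_mult cj_K OK_imp_K algebra_simps)
  define \<Delta> where "\<Delta> = \<omega> - cj \<omega>"
  have \<Delta>: "\<Delta> \<noteq> 0"
    using omega_ne_cj by (simp add: \<Delta>_def)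
  have W1: "W (\<mu> * a) (\<mu> * \<theta>) = \<mu> * cj \<mu> * a * u * \<Delta>"
  proof -
    have "W (\<mu> * a) (\<mu> * \<theta>) = \<mu> * cj \<mu> * a * (\<theta> - cj \<theta>)"
      using D by (simp add: W_def cj_mult cj_K algebra_simps)
    then show ?thesis
      using form_root_trace(3)[OF D(8,5)] by (simp add: \<theta>_def \<Delta>_def)
  qed
  have W2: "W a' \<theta>' = a' * u' * \<Delta>"
  proof -
    have "W a' \<theta>' = a' * (\<theta>' - cj \<theta>')"
      using D' by (simp add: W_def cj_K algebra_simps)
    then show ?thesis
      using form_root_trace(3)[OF D'(8,5)] by (simp add: \<theta>'_def \<Delta>_def)
  qed
  have a0: "a \<noteq> 0" "a' \<noteq> 0"
    using form_lead_nonzero Q Q' by auto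
  have u0: "u \<noteq> 0" "u' \<noteq> 0"
    using pos_unitD(3)[OF D(7)] pos_unitD(3)[OF D'(7)] by auto
  define d where "d = p * s - q * r"
  have e1: "W a' \<theta>' = d * W (\<mu> * a) (\<mu> * \<theta>)"
    using W_lin[of p q r s "\<mu> * a" "\<mu> * \<theta>"] pr qs by (simp add: d_def)
  have "W (\<mu> * a) (\<mu> * \<theta>) = (p' * s' - q' * r') * W a' \<theta>'"
    using W_lin[of p' q' r' s' a' \<theta>'] pr' qs' by simp
  then have "(d * (p' * s' - q' * r')) * W a' \<theta>' = W a' \<theta>'"
    using e1 by (simp add: mult.assoc)
  \<comment> \<open>\<open>W\<close> is nonzero on the generators, so the determinants of the two
    opposite base changes are mutually inverse.\<close>
  then have dd: "d * (p' * s' - q' * r') = 1"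
    using W2 a0 u0 \<Delta> by simp
  have N0: "\<mu> * cj \<mu> * a \<noteq> 0" "\<mu> * cj \<mu> * a \<in> K"
    using \<mu>0 a0 D by (auto simp: cj_eq_0_iff norm_K)
  have d: "d = (a' / (\<mu> * cj \<mu> * a)) * (u' * inverse u)"
    using e1 unfolding W1 W2 using \<Delta> u0 N0 by (simp add: field_simps)
  have "totally_positive K (a' / (\<mu> * cj \<mu> * a))"
    using sign sign_vector_eq_iff[OF D'(4) N0(2) a0(2) N0(1)] by simp
  then have "totally_positive K d"
    unfolding d using D(7) D'(7)
    by (intro totally_positive_mult totally_positive_inverse) (auto simp: pos_unitD)
  moreover have "d \<in> OK"
    using pr(1,2) qs(1,2) by (simp add: d_def)
  moreover have "inverse d = p' * s' - q' * r'"
    using dd by (rule inverse_unique)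
  then have "inverse d \<in> OK"
    using pr'(1,2) qs'(1,2) by simp
  ultimately have dU: "d \<in> pos_unit_set K"
    by (intro pos_unitI)
  \<comment> \<open>The multiplier is forced by \<open>v * a' = \<mu> * cj \<mu> * a\<close>, the
    comparison of leading coefficients below; in this shape it is visibly a totally positive
    unit.\<close>
  define v where "v = u' * inverse u * inverse d"
  have v: "v \<in> pos_unit_set K"
    unfolding v_def using D(7) D'(7) dU by (intro pos_unit_mult pos_unit_inverse)
  have va: "v * a' = \<mu> * cj \<mu> * a"
    unfolding v_def d using u0 a0 N0 by (simp add: field_simps)
  \<comment> \<open>The signs at \<open>q\<close> and \<open>r\<close> arise because the root enters
    the linear factor \<open>a * x - \<theta> * y\<close> negatively.\<close>
  have ev: "form_eval (a', b', c') x y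
      = v * form_eval (a, b, c) (p * x + (- q) * y) ((- r) * x + s * y)" if "x \<in> K" "y \<in> K" for x y
  proof -
    let ?X = "p * x + (- q) * y" and ?Y = "(- r) * x + s * y"
    have l: "a' * x - \<theta>' * y = \<mu> * (a * ?X - \<theta> * ?Y)"
      unfolding pr(3) qs(3) by (simp add: algebra_simps)
    have l': "a' * x - cj \<theta>' * y = cj \<mu> * (a * ?X - cj \<theta> * ?Y)"
      using arg_cong[OF l, of cj] that pr(1,2) qs(1,2) D(4) D'(4)
      by (simp add: cj_diff cj_add cj_minus cj_mult cj_K OK_imp_K)
    have "a' * form_eval (a', b', c') x y = (a' * x - \<theta>' * y) * (a' * x - cj \<theta>' * y)"
      unfolding \<theta>'_def by (rule form_factor[OF Q'])
    also have "\<dots> = \<mu> * cj \<mu> * ((a * ?X - \<theta> * ?Y) * (a * ?X - cj \<theta> * ?Y))"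
      unfolding l l' by (simp only: mult_ac)
    also have "\<dots> = \<mu> * cj \<mu> * (a * form_eval (a, b, c) ?X ?Y)"
      unfolding \<theta>_def by (simp only: form_factor[OF Q])
    also have "\<dots> = a' * (v * form_eval (a, b, c) ?X ?Y)"
      using va by (simp only: mult_ac) (simp only: mult.assoc[symmetric])
    finally show ?thesis
      using a0 by simp
  qed
  show ?thesis
    unfolding form_equiv_def
  proof (intro bexI ballI conjI)
    show "p * s - (- q) * (- r) \<in> pos_unit_set K"
      using dU by (simp add: d_def)
  qed (use ev v pr(1,2) qs(1,2) in auto)
qed

section \<open>Cubes\<close>

lemma integral_module_UNIV_imp_K: "integral_module UNIV M \<Longrightarrow> integral_module K M"
  by (auto simp: integral_module_def OK_imp_OL)

text \<open>Serves triple products: with one factor \<open>w\<close> fixed, the condition on the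
  other two becomes membership in a module, which can be tested on generators.\<close>

lemma integral_module_quotient:
  "integral_module K M \<Longrightarrow> integral_module K {x. x * w \<in> M}"
  by (simp add: integral_module_def distrib_right mult.assoc)

section \<open>Conjugate forms and norms of modules\<close>

lemma form_with_unit_conj:
  assumes "form_with_unit u (a, b, c)"
  shows "form_with_unit u (a, - b, c)"
proof -
  have "int_dvd K d (- b) \<Longrightarrow> int_dvd K d b" for d
    unfolding int_dvd_def by (metis OK_minus minus_minus mult_minus_right)
  then show ?thesis
    using assms by (auto simp: form_with_unit_def)
qed

lemma form_root_conj: "u \<in> K \<Longrightarrow> b \<in> K \<Longrightarrow> form_root u (- b) = - cj (form_root u b)"
  by (simp add: form_root_trace(1)) (simp add: form_root_def field_simps)

text \<open>Changing the sign of \<open>b\<close> replaces the root by minus its conjugate, and the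
  sign does not affect the span.\<close>

lemma form_module_conj:
  assumes "form_with_unit u (a, b, c)"
  shows "form_module u (a, - b, c) = cj ` form_module u (a, b, c)"
proof -
  note D = form_unitD[OF assms]
  let ?\<theta> = "form_root u b"
  have cj: "cj (x * a + y * ?\<theta>) = x * a + (- y) * (- cj ?\<theta>)" if "x \<in> OK" "y \<in> OK" for x y
    using that D by (simp add: cj_add cj_mult cj_K OK_imp_K)
  show ?thesis
    unfolding form_module_def fst_conv snd_conv form_root_conj[OF D(8,5)]
  proof (intro equalityI subsetI)
    fix z assume "z \<in> span2 K a (- cj ?\<theta>)"
    then obtain x y where xy: "x \<in> OK" "y \<in> OK" "z = x * a + y * (- cj ?\<theta>)"
      by (rule span2E)
    then have "z = cj (x * a + (- y) * ?\<theta>)"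
      using cj[of x "- y"] by simp
    then show "z \<in> cj ` span2 K a ?\<theta>"
      using span2_memI[of x "- y" a ?\<theta>] xy by blast
  next
    fix z assume "z \<in> cj ` span2 K a ?\<theta>"
    then obtain w where w: "w \<in> span2 K a ?\<theta>" "z = cj w"
      by blast
    from w(1) obtain x y where xy: "x \<in> OK" "y \<in> OK" "w = x * a + y * ?\<theta>"
      by (rule span2E)
    then have "z = x * a + (- y) * (- cj ?\<theta>)"
      using cj[of x y] w(2) by simp
    then show "z \<in> span2 K a (- cj ?\<theta>)"
      using span2_memI[of x "- y" a "- cj ?\<theta>"] xy by simp
  qed
qed

lemma span2_mult_subset:
  assumes "integral_module K M" "\<alpha> * w \<in> M" "\<beta> * w \<in> M" "v \<in> span2 K \<alpha> \<beta>"
  shows "v * w \<in> M"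
proof -
  obtain x y where "x \<in> OK" "y \<in> OK" "v = x * \<alpha> + y * \<beta>"
    using assms(4) by (rule span2E)
  then have "v * w = x * (\<alpha> * w) + y * (\<beta> * w)" "x \<in> OK" "y \<in> OK"
    by (simp_all add: algebra_simps)
  then show ?thesis
    using assms by (simp add: integral_module_def)
qed

lemma ideal_mult_span2_subset:
  assumes "integral_module K M" "\<alpha> * \<gamma> \<in> M" "\<alpha> * \<delta> \<in> M" "\<beta> * \<gamma> \<in> M" "\<beta> * \<delta> \<in> M"
  shows "ideal_mult (span2 K \<alpha> \<beta>) (span2 K \<gamma> \<delta>) \<subseteq> M"
proof (rule ideal_mult_least)
  fix v w assume v: "v \<in> span2 K \<alpha> \<beta>" and w: "w \<in> span2 K \<gamma> \<delta>"
  have "w * \<alpha> \<in> M" "w * \<beta> \<in> M"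
    using assms span2_mult_subset[OF assms(1) _ _ w, of \<alpha>] span2_mult_subset[OF assms(1) _ _ w, of \<beta>]
    by (simp_all add: mult.commute)
  then show "v * w \<in> M"
    using span2_mult_subset[OF assms(1) _ _ v, of w] by (simp add: mult.commute)
qed (use assms(1) in \<open>auto simp: integral_module_def\<close>)

text \<open>The four products of generators are multiples of \<open>a\<close>. Conversely they
  produce \<open>a * a\<close>, \<open>a * b\<close> and \<open>a * c\<close>, from which the Bezout
  identity of a primitive form recovers \<open>a\<close>.\<close>

lemma form_module_mult_conj:
  assumes "form_with_unit u (a, b, c)"
  shows "ideal_mult (form_module u (a, b, c)) (form_module u (a, - b, c)) = (*) a ` OL"
proof
  note D = form_unitD[OF assms]
  define \<theta> where "\<theta> = form_root u b"
  define \<theta>' where "\<theta>' = form_root u (- b)"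
  define P where "P = ideal_mult (form_module u (a, b, c)) (form_module u (a, - b, c))"
  have diff: "\<theta> - \<theta>' = - b" and prod: "\<theta> * \<theta>' = a * (- c)"
    using form_root_trace(2)[OF D(8,5)] form_root_norm[OF assms] D
    by (simp_all add: form_root_conj \<theta>_def \<theta>'_def)
  have M: "integral_module UNIV ((*) a ` OL)"
    by (intro integral_module_scale integral_module_OL)
  have OL: "\<theta> \<in> OL" "\<theta>' \<in> OL"
    using form_root_OL[OF assms] form_root_OL[OF form_with_unit_conj[OF assms]]
    by (auto simp: \<theta>_def \<theta>'_def)
  have P_eq: "P = ideal_mult (span2 K a \<theta>) (span2 K a \<theta>')"
    by (simp add: P_def form_module_def \<theta>_def \<theta>'_def)
  show "P \<subseteq> (*) a ` OL"
    unfolding P_eq using OL D by (intro ideal_mult_span2_subset integral_module_UNIV_imp_K M)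
      (auto simp: prod OK_imp_OL mult.commute[of \<theta> a] simp del: mult_minus_right)
  have P: "integral_module UNIV P"
    unfolding P_def by (intro integral_module_ideal_mult integral_module_form_module assms)
  have gens: "a * a \<in> P" "a * \<theta>' \<in> P" "\<theta> * a \<in> P" "\<theta> * \<theta>' \<in> P"
    unfolding P_eq by (auto intro!: ideal_mult_prod span2_gens)
  have "a \<noteq> 0" "integral_form K (a, b, c)"
    using form_lead_nonzero[OF assms] D by auto
  then obtain x y z where xyz: "x \<in> OK" "y \<in> OK" "z \<in> OK" "x * a + y * b + z * c = 1"
    using primitive_form_bezout form_unit_primitive[OF assms] by blast
  \<comment> \<open>The Bezout identity times \<open>a\<close>, with \<open>- b\<close> and
    \<open>a * (- c)\<close> then replaced by the difference and the product of the two
    roots.\<close>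
  have "a = a * (x * a + y * b + z * c)"
    by (simp add: xyz)
  also have "\<dots> = x * (a * a) + (- y) * (a * (- b)) + (- z) * (a * (- c))"
    by (simp add: algebra_simps)
  also have "\<dots> = x * (a * a) + (- y) * (\<theta> * a) + y * (a * \<theta>') + (- z) * (\<theta> * \<theta>')"
    unfolding diff[symmetric] prod by (simp add: algebra_simps)
  also have "\<dots> \<in> P"
    using P xyz gens by (simp add: integral_module_def OK_imp_OL del: mult_minus_left)
  finally show "(*) a ` OL \<subseteq> P"
    using P by (auto simp: integral_module_def mult.commute)
qed

lemma cj_ideal_mult: "ideal_mult (cj ` I) (cj ` J) = cj ` ideal_mult I J"
proof
  show "ideal_mult (cj ` I) (cj ` J) \<subseteq> cj ` ideal_mult I J"
  proof (rule ideal_mult_least)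
    show "0 \<in> cj ` ideal_mult I J"
      using ideal_mult_zero[of I J] cj_0 by (metis image_eqI)
  qed (auto simp flip: cj_mult cj_add intro: ideal_mult_prod ideal_mult_add)
  have "cj z \<in> ideal_mult (cj ` I) (cj ` J)" if "z \<in> ideal_mult I J" for z
    using that by (induction rule: ideal_mult_induct)
      (auto simp: cj_0 cj_add cj_mult ideal_mult_zero intro: ideal_mult_add_prod)
  then show "cj ` ideal_mult I J \<subseteq> ideal_mult (cj ` I) (cj ` J)"
    by blast
qed

text \<open>By the norms of the three modules, \<open>J\<close> times its conjugate is generated by
  \<kappa> * cj \<kappa>. Since the conjugate lies in the ideal of cj \<kappa>, that product lies in
  cj \<kappa> * J, and cancelling cj \<kappa> puts \<kappa> into \<open>J\<close>.\<close>

lemma product_principal_if_dvd: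
  assumes Q: "form_with_unit u (a1, b1, c1)" "form_with_unit u (a2, b2, c2)"
      "form_with_unit u (a3, b3, c3)"
    and J_def: "J = ideal_mult (ideal_mult (form_module u (a1, b1, c1)) (form_module u (a2, b2, c2)))
      (form_module u (a3, b3, c3))"
    and sub: "J \<subseteq> (*) \<kappa> ` OL"
    and norm: "\<kappa> * cj \<kappa> = a1 * a2 * a3"
  shows "J = (*) \<kappa> ` OL"
proof
  define J' where "J' = cj ` J"
  have "\<kappa> * cj \<kappa> \<noteq> 0"
    using norm form_lead_nonzero Q by auto
  then have k0: "cj \<kappa> \<noteq> 0"
    by auto
  have J: "integral_module UNIV J"
    unfolding J_def by (intro integral_module_ideal_mult integral_module_form_module Q)
  have "ideal_mult J J' = (*) (a1 * a2 * a3) ` OL"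
  proof -
    have "J' = ideal_mult (ideal_mult (form_module u (a1, - b1, c1)) (form_module u (a2, - b2, c2)))
        (form_module u (a3, - b3, c3))"
      unfolding J'_def J_def cj_ideal_mult[symmetric] form_module_conj[OF Q(1), symmetric]
        form_module_conj[OF Q(2), symmetric] form_module_conj[OF Q(3), symmetric] ..
    then have "ideal_mult J J'
      = ideal_mult (ideal_mult (form_module u (a1, b1, c1)) (form_module u (a1, - b1, c1)))
         (ideal_mult (ideal_mult (form_module u (a2, b2, c2)) (form_module u (a2, - b2, c2)))
           (ideal_mult (form_module u (a3, b3, c3)) (form_module u (a3, - b3, c3))))"
      unfolding J_def
      by (simp add: ideal_mult_assoc ideal_mult_commute ideal_mult_left_commute)
    then show ?thesis
      unfolding form_module_mult_conj[OF Q(1)] form_module_mult_conj[OF Q(2)]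
        form_module_mult_conj[OF Q(3)]
      by (simp add: ideal_mult_scale ideal_mult_scale_right ideal_mult_integers integral_module_OL)
        (simp add: image_image mult.assoc mult.left_commute)
  qed
  then have "\<kappa> * cj \<kappa> \<in> ideal_mult J J'"
    unfolding norm by (metis OL_1 image_eqI mult.right_neutral)
  also have "ideal_mult J J' \<subseteq> (*) (cj \<kappa>) ` J"
  proof (rule ideal_mult_least)
    fix x y assume x: "x \<in> J" and "y \<in> J'"
    then obtain w where "w \<in> OL" "y = cj (\<kappa> * w)"
      using sub unfolding J'_def by blast
    then have xy: "x * y = cj \<kappa> * (cj w * x)" and "cj w \<in> OL"
      by (simp_all add: cj_mult cj_OL)
    then have "cj w * x \<in> J"
      using J x by (simp add: integral_module_def)
    then show "x * y \<in> (*) (cj \<kappa>) ` J"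
      unfolding xy by blast
  qed (use integral_module_scale[OF J, of "cj \<kappa>"] in \<open>auto simp: integral_module_def\<close>)
  finally have "\<kappa> \<in> J"
    using k0 by auto
  then show "(*) \<kappa> ` OL \<subseteq> J"
    using J by (auto simp: integral_module_def mult.commute)
qed (rule sub)

section \<open>The product of the three modules of a cube\<close>

text \<open>Reduces a product with the root to an expression linear in the root, so that the
  relations between the quotients below become polynomial identities in the cube entries.\<close>

lemma form_root_times_linear:
  assumes "form_with_unit u (a, b, c)"
  shows "form_root u b * (x * form_root u b + y) = (y - x * b) * form_root u b - x * a * c"
proof -
  have "form_root u b * (x * form_root u b + y) = x * (form_root u b)\<^sup>2 + y * form_root u b"
    by (simp add: algebra_simps power2_eq_square)
  then show ?thesis
    unfolding form_root_square[OF assms] by (simp add: algebra_simps)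
qed

lemma cube_product_principal:
  assumes abcd: "a \<in> OK" "b \<in> OK" "c \<in> OK" "d \<in> OK" "e \<in> OK" "f \<in> OK" "g \<in> OK" "h \<in> OK"
    and a_def: "a1 = b * c - a * d" "a2 = c * e - a * g" "a3 = b * e - a * f"
    and b_def: "b1 = a * h - b * g - c * f + d * e" "b2 = a * h + b * g - c * f - d * e"
      "b3 = a * h - b * g + c * f - d * e"
    and c_def: "c1 = f * g - e * h" "c2 = d * f - b * h" "c3 = d * g - c * h"
    and Q: "form_with_unit u (a1, b1, c1)" "form_with_unit u (a2, b2, c2)"
      "form_with_unit u (a3, b3, c3)"
  obtains \<kappa> where "\<kappa> * cj \<kappa> = a1 * a2 * a3"
    "ideal_mult (ideal_mult (form_module u (a1, b1, c1)) (form_module u (a2, b2, c2)))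
      (form_module u (a3, b3, c3)) = (*) \<kappa> ` OL"
proof -
  note D1 = form_unitD[OF Q(1)] and D2 = form_unitD[OF Q(2)] and D3 = form_unitD[OF Q(3)]
  define t where "t = form_root u b1"
  define t2 where "t2 = form_root u b2"
  define t3 where "t3 = form_root u b3"
  \<comment> \<open>With a common \<open>u\<close> the roots differ by half the differences of the
    middle coefficients, which are integral expressions in the entries.\<close>
  have t2: "t2 = t + d * e - b * g" and t3: "t3 = t + d * e - c * f"
    by (simp_all add: t_def t2_def t3_def form_root_def b_def field_simps)
  have cjt: "cj t = - b1 - t"
    using form_root_trace(2)[OF D1(8,5)] by (simp add: t_def eq_diff_eq add.commute)
  have OL: "t \<in> OL" "t2 \<in> OL" "t3 \<in> OL"
    using form_root_OL[OF Q(1)] form_root_OL[OF Q(2)] form_root_OL[OF Q(3)]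
    by (simp_all add: t_def t2_def t3_def)
  \<comment> \<open>\<open>Xijk\<close> is the quotient by \<open>\<kappa>\<close> of the product of the \<open>i\<close>-th, \<open>j\<close>-th and \<open>k\<close>-th generators; its
    coefficient at the root is the cube entry with index \<open>ijk\<close>.\<close>
  define \<kappa> where "\<kappa> = e * a1 - a * t"
  define X111 where "X111 = e * a1 + a * (t + b1)"
  define X211 where "X211 = e * t - a * c1"
  define X121 where "X121 = b * t2 - a * c2"
  define X112 where "X112 = c * t3 - a * c3"
  define X221 where "X221 = f * t - b * c1"
  define X212 where "X212 = g * t - c * c1"
  define X122 where "X122 = d * t2 - c * c2"
  define X222 where "X222 = h * t - d * c1"
  note X = X111_def X211_def X121_def X112_def X221_def X212_def X122_def X222_def
  note lin = form_root_times_linear[OF Q(1), folded t_def] form_root_times_linear[OF Q(2), folded t2_def]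
    form_root_times_linear[OF Q(3), folded t3_def]
  note co = a_def b_def c_def
  \<comment> \<open>The quotients rewritten as linear expressions in the root they are about to be
    multiplied by, as \<open>lin\<close> requires.\<close>
  have e1: "X111 = a * t + (e * a1 + a * b1)" "X121 = b * t + (b * (d * e - b * g) - a * c2)"
    "X112 = c * t + (c * (d * e - c * f) - a * c3)" "X122 = d * t + (d * (d * e - b * g) - c * c2)"
    by (simp_all add: X t2 t3 algebra_simps)
  have e2: "X111 = a * t2 + (e * a1 + a * b1 - a * (d * e - b * g))"
    "X112 = c * t2 + (c * (b * g - c * f) - a * c3)"
    by (simp_all add: X t2 t3 algebra_simps)
  have e3: "X111 = a * t3 + (e * a1 + a * b1 - a * (d * e - c * f))"
    by (simp add: X t3 algebra_simps)
  \<comment> \<open>Replacing the leading coefficient of the i-th form by its root changes the i-th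
    index of the quotient from 1 to 2; \<open>r1\<close>, \<open>r2\<close> and \<open>r3\<close>
    treat the three indices.\<close>
  have r1: "t * X111 = a1 * X211" "t * X121 = a1 * X221" "t * X112 = a1 * X212" "t * X122 = a1 * X222"
    unfolding e1 lin(1) X211_def X221_def X212_def X222_def by (simp_all add: co algebra_simps)
  have r2: "t2 * X111 = a2 * X121" "t2 * X112 = a2 * X122"
    unfolding e2 lin(2) X121_def X122_def by (simp_all add: co algebra_simps)
  have r3: "t3 * X111 = a3 * X112"
    unfolding e3 lin(3) X112_def by (simp add: co algebra_simps)
  have n: "\<kappa> * X111 = a1 * a2 * a3"
  proof -
    have "\<kappa> * X111 = e * a1 * (e * a1 + a * b1) - a * (t * (a * t + a * b1))"
      by (simp add: \<kappa>_def X111_def algebra_simps)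
    then show ?thesis
      unfolding lin(1) by (simp add: co algebra_simps)
  qed
  \<comment> \<open>Hence \<open>n\<close> is the norm formula for \<kappa>.\<close>
  have cjk: "cj \<kappa> = X111"
    using abcd D1 by (simp add: \<kappa>_def X111_def cj_diff cj_mult cj_K OK_imp_K cjt algebra_simps)
  have nz: "a1 \<noteq> 0" "a2 \<noteq> 0" "a3 \<noteq> 0"
    using form_lead_nonzero Q by auto
  then have k0: "\<kappa> \<noteq> 0" "X111 \<noteq> 0"
    using n by auto
  have p: "a1 * a2 * a3 = \<kappa> * X111" "t * a2 * a3 = \<kappa> * X211" "a1 * t2 * a3 = \<kappa> * X121"
    "a1 * a2 * t3 = \<kappa> * X112" "t * t2 * a3 = \<kappa> * X221" "t * a2 * t3 = \<kappa> * X212"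
    "a1 * t2 * t3 = \<kappa> * X122" "t * t2 * t3 = \<kappa> * X222"
  proof -
    \<comment> \<open>Exchanges the generator \<open>x\<close> for \<open>y\<close> in a product
      known to be divisible by \<kappa>. All eight divisibilities follow from that of
      \<open>a1 * a2 * a3\<close> by changing one generator at a time.\<close>
    have step: "y * s = \<kappa> * Z" if "x \<noteq> 0" "x * s = \<kappa> * Y" "y * Y = x * Z" for x y s Y Z
    proof -
      have "x * (y * s) = y * (x * s)"
        by simp
      also have "\<dots> = \<kappa> * (y * Y)"
        unfolding that(2) by simp
      also have "\<dots> = x * (\<kappa> * Z)"
        unfolding that(3) by simp
      finally show ?thesis
        using that(1) by simp
    qed
    show p111: "a1 * a2 * a3 = \<kappa> * X111"
      using n ..
    show "t * a2 * a3 = \<kappa> * X211"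
      using step[OF nz(1) _ r1(1), of "a2 * a3"] p111 by (simp add: mult.assoc)
    show p121: "a1 * t2 * a3 = \<kappa> * X121"
      using step[OF nz(2) _ r2(1), of "a1 * a3"] p111 by (simp add: mult_ac)
    show p112: "a1 * a2 * t3 = \<kappa> * X112"
      using step[OF nz(3) _ r3, of "a1 * a2"] p111 by (simp add: mult_ac)
    show "t * t2 * a3 = \<kappa> * X221"
      using step[OF nz(1) _ r1(2), of "t2 * a3"] p121 by (simp add: mult.assoc)
    show "t * a2 * t3 = \<kappa> * X212"
      using step[OF nz(1) _ r1(3), of "a2 * t3"] p112 by (simp add: mult.assoc)
    show p122: "a1 * t2 * t3 = \<kappa> * X122"
      using step[OF nz(2) _ r2(2), of "a1 * t3"] p112 by (simp add: mult_ac)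
    show "t * t2 * t3 = \<kappa> * X222"
      using step[OF nz(1) _ r1(4), of "t2 * t3"] p122 by (simp add: mult.assoc)
  qed
  have XOL: "X111 \<in> OL" "X211 \<in> OL" "X121 \<in> OL" "X112 \<in> OL" "X221 \<in> OL" "X212 \<in> OL" "X122 \<in> OL"
    "X222 \<in> OL"
    using OL abcd D1 D2 D3 by (simp_all add: X OK_imp_OL)
  have M: "integral_module K ((*) \<kappa> ` OL)"
    by (intro integral_module_UNIV_imp_K integral_module_scale integral_module_OL)
  have "ideal_mult (ideal_mult (span2 K a1 t) (span2 K a2 t2)) (span2 K a3 t3) \<subseteq> (*) \<kappa> ` OL"
  proof (rule ideal_mult_least)
    fix v w assume v: "v \<in> ideal_mult (span2 K a1 t) (span2 K a2 t2)" and w: "w \<in> span2 K a3 t3"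
    \<comment> \<open>The third factor is reduced to its two generators first; the other two factors
      are then tested in the quotient module for fixed \<open>w\<close>.\<close>
    have *: "x * w \<in> (*) \<kappa> ` OL" if "x * a3 \<in> (*) \<kappa> ` OL" "x * t3 \<in> (*) \<kappa> ` OL" for x
      using span2_mult_subset[OF M _ _ w, of x] that by (simp add: mult.commute)
    have Mw: "integral_module K {x. x * w \<in> (*) \<kappa> ` OL}"
      by (rule integral_module_quotient[OF M])
    have "ideal_mult (span2 K a1 t) (span2 K a2 t2) \<subseteq> {x. x * w \<in> (*) \<kappa> ` OL}"
      by (intro ideal_mult_span2_subset Mw) (auto intro!: * simp: p XOL)
    then show "v * w \<in> (*) \<kappa> ` OL"
      using v by blast
  qed (use M in \<open>auto simp: integral_module_def\<close>)
  then show thesis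
    using that[of \<kappa>] product_principal_if_dvd[OF Q refl, of \<kappa>]
    by (simp add: n cjk form_module_def t_def t2_def t3_def)
qed

section \<open>Psi on classes of forms\<close>

lemma form_class_Psi:
  assumes "form_with_unit u (a, b, c)"
  shows "Psi K cj \<omega> (form_class K cj \<omega> (a, b, c)) = oriented_class (form_module u (a, b, c)) a"
proof -
  have *: "form_ideal_class K cj \<omega> (a, b, c) = oriented_class (form_module u (a, b, c)) a"
    if "form_with_unit u (a, b, c)" for u a b c
    using that by (simp only: form_ideal_class_def oriented_class_def form_ideal_eq)
  have "form_ideal_class K cj \<omega> ` form_class K cj \<omega> (a, b, c)
      = {oriented_class (form_module u (a, b, c)) a}"
  proof (intro equalityI subsetI)
    fix C assume "C \<in> form_ideal_class K cj \<omega> ` form_class K cj \<omega> (a, b, c)"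
    then obtain a' b' c' where C: "C = form_ideal_class K cj \<omega> (a', b', c')"
      "(a', b', c') \<in> forms_with_disc K cj \<omega>" "form_equiv K (a, b, c) (a', b', c')"
      by (auto simp: form_class_def form_rel_def)
    then obtain u' where "form_with_unit u' (a', b', c')"
      by (auto simp: forms_with_disc_iff)
    then show "C \<in> {oriented_class (form_module u (a, b, c)) a}"
      using form_equiv_imp_class_eq[OF assms _ C(3)] C(1) * by simp
  next
    \<comment> \<open>Reflexivity of the equivalence is read off from the trivial equality of
      oriented classes.\<close>
    have "(a, b, c) \<in> form_class K cj \<omega> (a, b, c)"
      using class_eq_imp_form_equiv[OF assms assms refl] assms
      by (auto simp: form_class_def form_rel_def forms_with_disc_iff)
    then show "C \<in> form_ideal_class K cj \<omega> ` form_class K cj \<omega> (a, b, c)"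
      if "C \<in> {oriented_class (form_module u (a, b, c)) a}" for C
      using that *[OF assms] by auto
  qed
  then show ?thesis
    by (simp add: Psi_def)
qed

lemma form_class_in_QF: "form_with_unit u Q \<Longrightarrow> form_class K cj \<omega> Q \<in> QF K cj \<omega>"
  unfolding QF_def form_class_def by (intro quotientI) (auto simp: forms_with_disc_iff)

lemma QF_cases:
  assumes "X \<in> QF K cj \<omega>"
  obtains u a b c where "form_with_unit u (a, b, c)" "X = form_class K cj \<omega> (a, b, c)"
  using assms unfolding QF_def form_class_def by (auto elim!: quotientE simp: forms_with_disc_iff)

text \<open>Equivalence of forms coincides with equality of oriented classes. Representatives with
  the same image therefore have the same equivalent forms; symmetry and transitivity are inherited
  from equality.\<close>

lemma inj_on_Psi: "inj_on (Psi K cj \<omega>) (QF K cj \<omega>)"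
proof (rule inj_onI)
  fix X Y assume X: "X \<in> QF K cj \<omega>" and Y: "Y \<in> QF K cj \<omega>" and eq: "Psi K cj \<omega> X = Psi K cj \<omega> Y"
  have equiv_iff: "form_equiv K (a, b, c) (a', b', c') \<longleftrightarrow>
      oriented_class (form_module u (a, b, c)) a = oriented_class (form_module u' (a', b', c')) a'"
    if "form_with_unit u (a, b, c)" "form_with_unit u' (a', b', c')" for u a b c u' a' b' c'
    using form_equiv_imp_class_eq[OF that] class_eq_imp_form_equiv[OF that] by auto
  have sub: "X \<subseteq> Y" if XY: "X \<in> QF K cj \<omega>" "Y \<in> QF K cj \<omega>" "Psi K cj \<omega> X = Psi K cj \<omega> Y" for X Y
  proof
    fix R assume R: "R \<in> X"
    obtain u a b c where Q: "form_with_unit u (a, b, c)" "X = form_class K cj \<omega> (a, b, c)"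
      using XY(1) by (rule QF_cases)
    obtain u' a' b' c' where Q': "form_with_unit u' (a', b', c')" "Y = form_class K cj \<omega> (a', b', c')"
      using XY(2) by (rule QF_cases)
    obtain a'' b'' c'' where R': "R = (a'', b'', c'')"
      by (cases R)
    then obtain u'' where R'': "form_with_unit u'' (a'', b'', c'')" "form_equiv K (a, b, c) (a'', b'', c'')"
      using R Q(2) by (auto simp: form_class_def form_rel_def forms_with_disc_iff)
    have "form_equiv K (a', b', c') (a'', b'', c'')"
      using R''(2) XY(3) equiv_iff[OF Q(1) R''(1)] equiv_iff[OF Q'(1) R''(1)]
        form_class_Psi[OF Q(1)] form_class_Psi[OF Q'(1)] Q(2) Q'(2) by simp
    then show "R \<in> Y"
      using Q' R' R''(1) by (auto simp: form_class_def form_rel_def forms_with_disc_iff)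
  qed
  show "X = Y"
    using sub[OF X Y eq] sub[OF Y X eq[symmetric]] by blast
qed

text \<open>Evaluates the transported operation once a form with the required oriented class has
  been exhibited; injectivity identifies its class.\<close>

lemma the_inv_into_Psi:
  assumes "form_with_unit u (a, b, c)"
  shows "the_inv_into (QF K cj \<omega>) (Psi K cj \<omega>) (oriented_class (form_module u (a, b, c)) a)
    = form_class K cj \<omega> (a, b, c)"
  using the_inv_into_f_f[OF inj_on_Psi form_class_in_QF[OF assms]] form_class_Psi[OF assms] by simp

text \<open>For \<open>u = 1\<close> the root of this form is \<omega> itself, so its module is
  spanned by the integral basis.\<close>

lemma identity_form:
  shows form_with_unit_identity: "form_with_unit 1 (1, - (\<omega> + cj \<omega>), \<omega> * cj \<omega>)"
    and form_module_identity: "form_module 1 (1, - (\<omega> + cj \<omega>), \<omega> * cj \<omega>) = OL"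
proof -
  have "d \<in> unit_set K" if "int_dvd K d 1" "d \<in> OK" for d
    using that by (auto simp: int_dvd_def unit_set_def)
  moreover have "(- \<omega> - cj \<omega>)\<^sup>2 - 4 * (\<omega> * cj \<omega>) = (\<omega> - cj \<omega>)\<^sup>2"
    by (simp add: power2_eq_square algebra_simps)
  ultimately show "form_with_unit 1 (1, - (\<omega> + cj \<omega>), \<omega> * cj \<omega>)"
    using omega_trace_norm OK_minus[OF omega_trace_norm(1)] pos_unit_1
    by (simp add: form_with_unit_def)
  have "form_root 1 (- (\<omega> + cj \<omega>)) = \<omega>"
    by (simp add: form_root_def)
  then show "form_module 1 (1, - (\<omega> + cj \<omega>), \<omega> * cj \<omega>) = OL"
    by (simp add: form_module_def integral_basis)
qed

end

section \<open>Composition of the three forms of a cube\<close>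

theorem theorem4p2:
  fixes K :: "'a::field_char_0 set" and cj :: "'a \<Rightarrow> 'a" and \<omega> :: 'a and A :: "'a cube"
  assumes "is_number_field K"
    and "real_embeddings K \<noteq> {}"
    and "narrow_class_number K = 1"
    and "is_quadratic_extension K"
    and "is_nontrivial_automorphism K cj"
    and "integers_of UNIV = span2 K 1 \<omega>"
    and "integral_cube K A"
    and "projective_cube K A"
    and "cube_disc A \<in> disc_set K cj \<omega>"
  shows "form_class K cj \<omega> (cube_form1 A) \<otimes>\<^bsub>QF_group K cj \<omega>\<^esub> form_class K cj \<omega> (cube_form2 A)
           \<otimes>\<^bsub>QF_group K cj \<omega>\<^esub> form_class K cj \<omega> (cube_form3 A) = \<one>\<^bsub>QF_group K cj \<omega>\<^esub>
       \<and> \<one>\<^bsub>QF_group K cj \<omega>\<^esub> = form_class K cj \<omega> (1, - (\<omega> + cj \<omega>), \<omega> * cj \<omega>)"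
proof -
  interpret quadratic_order K cj \<omega>
    using assms by unfold_locales
  obtain u where u: "u \<in> pos_unit_set K" "cube_disc A = u\<^sup>2 * (\<omega> - cj \<omega>)\<^sup>2"
    using assms(9) by (auto simp: disc_set_def)
  define a where "a = A 1 1 1"
  define b where "b = A 1 2 1"
  define c where "c = A 1 1 2"
  define d where "d = A 1 2 2"
  define e where "e = A 2 1 1"
  define f where "f = A 2 2 1"
  define g where "g = A 2 1 2"
  define h where "h = A 2 2 2"
  note entries = a_def b_def c_def d_def e_def f_def g_def h_def
  have ints: "a \<in> OK" "b \<in> OK" "c \<in> OK" "d \<in> OK" "e \<in> OK" "f \<in> OK" "g \<in> OK" "h \<in> OK"
    using assms(7) by (simp_all add: integral_cube_def entries)
  obtain a1 b1 c1 where Q1: "cube_form1 A = (a1, b1, c1)"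
    by (cases "cube_form1 A")
  obtain a2 b2 c2 where Q2: "cube_form2 A = (a2, b2, c2)"
    by (cases "cube_form2 A")
  obtain a3 b3 c3 where Q3: "cube_form3 A = (a3, b3, c3)"
    by (cases "cube_form3 A")
  have co1: "a1 = b * c - a * d" "b1 = a * h - b * g - c * f + d * e" "c1 = f * g - e * h"
    using Q1 by (simp_all add: cube_form1_def entries Let_def)
  have co2: "a2 = c * e - a * g" "b2 = a * h + b * g - c * f - d * e" "c2 = d * f - b * h"
    using Q2 by (simp_all add: cube_form2_def entries Let_def)
  have co3: "a3 = b * e - a * f" "b3 = a * h - b * g + c * f - d * e" "c3 = d * g - c * h"
    using Q3 by (simp_all add: cube_form3_def entries Let_def)
  \<comment> \<open>The three discriminants agree, so a single unit \<open>u\<close> serves all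
    three forms.\<close>
  have F: "form_with_unit u (a1, b1, c1)" "form_with_unit u (a2, b2, c2)" "form_with_unit u (a3, b3, c3)"
    using u assms(8) form_disc_cube_form[of A] ints unfolding projective_cube_def Q1 Q2 Q3
    by (simp_all add: form_with_unit_def co1 co2 co3)
  have F3': "form_with_unit u (a3, - b3, c3)"
    using F(3) by (rule form_with_unit_conj)
  define I1 where "I1 = form_module u (a1, b1, c1)"
  define I2 where "I2 = form_module u (a2, b2, c2)"
  define I3 where "I3 = form_module u (a3, b3, c3)"
  define I3' where "I3' = form_module u (a3, - b3, c3)"
  note Is = I1_def I2_def I3_def I3'_def
  have I: "integral_module UNIV I1" "integral_module UNIV I2" "integral_module UNIV I3"
    "integral_module UNIV I3'"
    unfolding Is using F F3' by (auto intro: integral_module_form_module)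
  have K: "a1 \<in> K" "a2 \<in> K" "a3 \<in> K"
    using F form_unitD(4) by blast+
  obtain \<kappa> where norm: "\<kappa> * cj \<kappa> = a1 * a2 * a3"
    and prin: "ideal_mult (ideal_mult I1 I2) I3 = (*) \<kappa> ` OL"
    using cube_product_principal[OF ints co1(1) co2(1) co3(1) co1(2) co2(2) co3(2)
        co1(3) co2(3) co3(3) F] unfolding Is by blast
  have a3: "a3 \<noteq> 0"
    using form_lead_nonzero F by blast
  have k0: "\<kappa> \<noteq> 0"
    using norm form_lead_nonzero F by fastforce
  have conj: "ideal_mult I3 I3' = (*) a3 ` OL"
    unfolding Is by (rule form_module_mult_conj[OF F(3)])
  \<comment> \<open>Multiplying the principal product of the three modules by \<open>I3'\<close>
    replaces the third module by its norm ideal, generated by \<open>a3\<close>.\<close>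
  have scaled: "(*) a3 ` ideal_mult I1 I2 = (*) \<kappa> ` I3'"
  proof -
    have "(*) \<kappa> ` I3' = ideal_mult (ideal_mult (ideal_mult I1 I2) I3) I3'"
      unfolding prin by (simp add: ideal_mult_scale ideal_mult_integers I)
    also have "\<dots> = ideal_mult (ideal_mult I1 I2) ((*) a3 ` OL)"
      by (simp add: ideal_mult_assoc conj)
    also have "\<dots> = (*) a3 ` ideal_mult (ideal_mult I1 I2) OL"
      by (rule ideal_mult_scale_right)
    also have "ideal_mult (ideal_mult I1 I2) OL = ideal_mult I1 I2"
      using ideal_mult_integers[of UNIV "ideal_mult I1 I2"] I
      by (simp add: ideal_mult_commute integral_module_ideal_mult)
    finally show ?thesis ..
  qed
  have "oriented_class I1 a1 <#>\<^bsub>oriented_ideal_group K\<^esub> oriented_class I2 a2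
      = oriented_class (ideal_mult I1 I2) (a1 * a2)"
    by (rule oriented_class_mult[OF I(1) K(1) I(2) K(2)])
  also have "\<dots> = oriented_class ((*) a3 ` ideal_mult I1 I2) (a3 * cj a3 * (a1 * a2))"
    using oriented_class_scale[OF integral_module_ideal_mult[OF I(1), of I2] K_mult[OF K(1,2)] a3] ..
  \<comment> \<open>The orientations match: \<open>a3\<close> is fixed by \<open>cj\<close>, and the
    norm of \<kappa> is \<open>a1 * a2 * a3\<close>.\<close>
  also have "a3 * cj a3 * (a1 * a2) = \<kappa> * cj \<kappa> * a3"
    using K by (simp add: norm cj_K)
  also have "oriented_class ((*) a3 ` ideal_mult I1 I2) (\<kappa> * cj \<kappa> * a3) = oriented_class I3' a3"
    unfolding scaled by (rule oriented_class_scale[OF I(4) K(3) k0])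
  finally have "form_class K cj \<omega> (cube_form1 A) \<otimes>\<^bsub>QF_group K cj \<omega>\<^esub> form_class K cj \<omega> (cube_form2 A)
      = form_class K cj \<omega> (a3, - b3, c3)"
    using the_inv_into_Psi[OF F3'] form_class_Psi[OF F(1)] form_class_Psi[OF F(2)]
    by (simp add: QF_group_def relative_class_group_def Q1 Q2 Is)
  \<comment> \<open>The neutral element of the quotient is the set of principal oriented ideals,
    which is the oriented class of the identity form.\<close>
  moreover have one: "\<one>\<^bsub>QF_group K cj \<omega>\<^esub> = form_class K cj \<omega> (1, - (\<omega> + cj \<omega>), \<omega> * cj \<omega>)"
    using the_inv_into_Psi[OF form_with_unit_identity, unfolded form_module_identity oriented_class_one]
    by (simp add: QF_group_def relative_class_group_def)
  \<comment> \<open>Conjugate modules multiply to the ideal of \<open>a3\<close>, and the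
    orientation \<open>a3 * a3\<close> is the norm of that same generator.\<close>
  moreover have "oriented_class I3' a3 <#>\<^bsub>oriented_ideal_group K\<^esub> oriented_class I3 a3
      = oriented_class OL 1"
  proof -
    have "oriented_class I3' a3 <#>\<^bsub>oriented_ideal_group K\<^esub> oriented_class I3 a3
        = oriented_class ((*) a3 ` OL) (a3 * cj a3 * 1)"
      using oriented_class_mult[OF I(4) K(3) I(3) K(3)] conj K(3)
      by (simp add: ideal_mult_commute cj_K)
    also have "\<dots> = oriented_class OL 1"
      by (rule oriented_class_scale[OF integral_module_OL K_1 a3])
    finally show ?thesis .
  qed
  then have "form_class K cj \<omega> (a3, - b3, c3) \<otimes>\<^bsub>QF_group K cj \<omega>\<^esub> form_class K cj \<omega> (cube_form3 A)
      = \<one>\<^bsub>QF_group K cj \<omega>\<^esub>"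
    using form_class_Psi[OF F(3)] form_class_Psi[OF F3']
    by (simp add: QF_group_def relative_class_group_def Q3 Is oriented_class_one)
  ultimately show ?thesis
    by simp
qed

end
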